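(* For every integer $M\ge 1$ and every $i\in\{0,\dots,L-1\}$, the transition kernel $S^M_i$ on $\mathbb{R}^{d_0}\times\dots\times\mathbb{R}^{d_L}$ (defined in the context) satisfies the detailed balance condition for the measure with density $\Pi$, i.e. $$\Pi(x)\,S^M_i(x\rightarrow y)=\Pi(y)\,S^M_i(y\rightarrow x),\qquad x,y\in\mathbb{R}^{d_0}\times\dots\times\mathbb{R}^{d_L},$$ where the identity is understood as an equality of measures on pairs $(x,y)$: $\Pi(x)\,dx\,S^M_i(x\rightarrow dy)=\Pi(y)\,dy\,S^M_i(y\rightarrow dx)$.
   Context: Let $L\ge 1$ and let $d_0>d_1>\dots>d_L\ge 1$ be integers. For each $i\in\{0,\dots,L\}$ let $\pi_i$ be a probability density (with respect to Lebesgue measure) on $\mathbb{R}^{d_i}$. Define $\Pi(x_0,\dots,x_L)=\pi_0(x_0)\cdots\pi_L(x_L)$ on $\mathbb{R}^{d_0}\times\dots\times\mathbb{R}^{d_L}$. For $i<L$, the coordinates of $x_i\in\mathbb{R}^{d_i}$ are split as $x_i=(\hat{x}_i,\tilde{x}_i)$ with $\hat{x}_i\in\mathbb{R}^{d_{i+1}}$ and $\tilde{x}_i\in\mathbb{R}^{d_i-d_{i+1}}$. For each $i<L$ let $p_i(\,\cdot\,\vert\hat{x}_i)$ be a reference conditional density: for each $\hat{x}_i\in\mathbb{R}^{d_{i+1}}$ it is a probability density on $\mathbb{R}^{d_i-d_{i+1}}$, jointly measurable in its two arguments. The kernel $S^M_i$ is the law of the next state produced from the current state $x=(\dots,\hat{x}_i,\tilde{x}_i,x_{i+1},\dots)$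 by the following steps. 1. Set $v^0=\tilde{x}_i$ and let $v^1,\dots,v^{M-1}$ be independent samples from $p_i(\,\cdot\,\vert\hat{x}_i)$. 2. Let $u^0,\dots,u^{M-1}$ be independent samples from $p_i(\,\cdot\,\vert x_{i+1})$, independent of the $v^j$. 3. Define the weights $w^j_v=\dfrac{\pi_i(\hat{x}_i,v^j)}{p_i(v^j\vert\hat{x}_i)}$ and $w^j_u=\dfrac{\pi_i(x_{i+1},u^j)}{p_i(u^j\vert x_{i+1})}$. 4. Choose $\tilde{y}_i$ from among $u^0,\dots,u^{M-1}$, choosing $u^j$ with probability $w^j_u/\sum_{l=0}^{M-1}w^l_u$. 5. With probability $$A^M_i=\min\Big\{1,\ \frac{\pi_{i+1}(\hat{x}_i)\sum_{j=0}^{M-1}w^j_u}{\pi_{i+1}(x_{i+1})\sum_{j=0}^{M-1}w^j_v}\Big\}$$ move to $y=(\dots,x_{i+1},\tilde{y}_i,\hat{x}_i,\dots)$, i.e. $\hat{y}_i=x_{i+1}$, $y_{i+1}=\hat{x}_i$, and $y_j=x_j$ for $j\notin\{i,i+1\}$. With probability $1-A^M_i$ stay at $x$. Equivalently, in density notation with Dirac deltas, $$S^M_i(x\rightarrow y)=\Big(1-\int R(x,\tilde{z})\,d\tilde{z}\Big)\delta_{\{y=x\}}+R(x,\tilde{y}_i)\,\delta_{\{(\hat{y}_i,y_{i+1})=(x_{i+1},\hat{x}_i)\}}\prod_{j\notin\{i,i+1\}}\delta_{\{y_j=x_j\}},$$ where $$R(x,u^0)=M\int p_i(u^0\vert x_{i+1})\,\frac{w^0_u}{\sum_{j=0}^{M-1}w^j_u}\,A^M_i\prod_{j=1}^{M-1}p_i(v^j\vert\hat{x}_i)\,p_i(u^j\vert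 x_{i+1})\,dv^j\,du^j,\qquad v^0=\tilde{x}_i .$$ Convention: if any ratio appearing in steps 3–5 is undefined because of a zero denominator (i.e. $p_i(\tilde{x}_i\vert\hat{x}_i)=0$, or $\sum_j w^j_u=0$, or $\pi_{i+1}(x_{i+1})\sum_j w^j_v=0$), the move is rejected ($A^M_i=0$). *)

theory Defs
  imports "HOL-Probability.Probability"
begin

text \<open>
  Euclidean space of dimension \<open>n\<close> is the product measure space of functions on \<open>{..<n}\<close>.
  The splitting of a vector of dimension \<open>d i\<close> keeps the coordinate labels: the hat part lives on
  \<open>{..<d (Suc i)}\<close>, the tilde part on \<open>{d (Suc i)..<d i}\<close> (which has \<open>d i - d (Suc i)\<close> elements),
  and \<^const>\<open>merge\<close> puts the two parts together.
\<close>

abbreviation euclid :: "nat set \<Rightarrow> (nat \<Rightarrow> real) measure" where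
  "euclid I \<equiv> \<Pi>\<^sub>M k\<in>I. lborel"

abbreviation hat_ix :: "(nat \<Rightarrow> nat) \<Rightarrow> nat \<Rightarrow> nat set" where
  "hat_ix d i \<equiv> {..<d (Suc i)}"

abbreviation tilde_ix :: "(nat \<Rightarrow> nat) \<Rightarrow> nat \<Rightarrow> nat set" where
  "tilde_ix d i \<equiv> {d (Suc i)..<d i}"

abbreviation state_space :: "nat \<Rightarrow> (nat \<Rightarrow> nat) \<Rightarrow> (nat \<Rightarrow> nat \<Rightarrow> real) measure" where
  "state_space L d \<equiv> \<Pi>\<^sub>M j\<in>{..L}. euclid {..<d j}"

definition prob_density :: "'a measure \<Rightarrow> ('a \<Rightarrow> real) \<Rightarrow> bool" where
  "prob_density N f \<longleftrightarrow>
     f \<in> borel_measurable N \<and> (\<forall>x\<in>space N. 0 \<le> f x) \<and> (\<integral>\<^sup>+x. ennreal (f x) \<partial>N) = 1"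

definition cond_prob_density :: "'a measure \<Rightarrow> 'b measure \<Rightarrow> ('a \<Rightarrow> 'b \<Rightarrow> real) \<Rightarrow> bool" where
  "cond_prob_density H N q \<longleftrightarrow>
     (\<lambda>(h, v). q h v) \<in> borel_measurable (H \<Otimes>\<^sub>M N) \<and> (\<forall>h\<in>space H. prob_density N (q h))"

definition target_density ::
  "nat \<Rightarrow> (nat \<Rightarrow> (nat \<Rightarrow> real) \<Rightarrow> real) \<Rightarrow> (nat \<Rightarrow> nat \<Rightarrow> real) \<Rightarrow> real" where
  "target_density L \<pi> x = (\<Prod>j\<le>L. \<pi> j (x j))"

definition target_measure ::
  "nat \<Rightarrow> (nat \<Rightarrow> nat) \<Rightarrow> (nat \<Rightarrow> (nat \<Rightarrow> real) \<Rightarrow> real) \<Rightarrow> (nat \<Rightarrow> nat \<Rightarrow> real) measure" where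
  "target_measure L d \<pi> = density (state_space L d) (\<lambda>x. ennreal (target_density L \<pi> x))"

definition weight ::
  "(nat \<Rightarrow> nat) \<Rightarrow> (nat \<Rightarrow> (nat \<Rightarrow> real) \<Rightarrow> real) \<Rightarrow> (nat \<Rightarrow> (nat \<Rightarrow> real) \<Rightarrow> (nat \<Rightarrow> real) \<Rightarrow> real)
    \<Rightarrow> nat \<Rightarrow> (nat \<Rightarrow> real) \<Rightarrow> (nat \<Rightarrow> real) \<Rightarrow> real" where
  "weight d \<pi> p i h t = \<pi> i (merge (hat_ix d i) (tilde_ix d i) (h, t)) / p i h t"

definition total_weight ::
  "(nat \<Rightarrow> nat) \<Rightarrow> (nat \<Rightarrow> (nat \<Rightarrow> real) \<Rightarrow> real) \<Rightarrow> (nat \<Rightarrow> (nat \<Rightarrow> real) \<Rightarrow> (nat \<Rightarrow> real) \<Rightarrow> real)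
    \<Rightarrow> nat \<Rightarrow> nat \<Rightarrow> (nat \<Rightarrow> real) \<Rightarrow> (nat \<Rightarrow> nat \<Rightarrow> real) \<Rightarrow> real" where
  "total_weight d \<pi> p M i h v = (\<Sum>j<M. weight d \<pi> p i h (v j))"

text \<open>
  In the next two definitions \<open>h\<close> is the hat part of the current \<open>x i\<close> and \<open>h'\<close> is \<open>x (Suc i)\<close>.
  The first one says that no denominator in the construction vanishes.
\<close>

definition ratios_defined ::
  "(nat \<Rightarrow> nat) \<Rightarrow> (nat \<Rightarrow> (nat \<Rightarrow> real) \<Rightarrow> real) \<Rightarrow> (nat \<Rightarrow> (nat \<Rightarrow> real) \<Rightarrow> (nat \<Rightarrow> real) \<Rightarrow> real)
    \<Rightarrow> nat \<Rightarrow> nat \<Rightarrow> (nat \<Rightarrow> real) \<Rightarrow> (nat \<Rightarrow> real) \<Rightarrow> (nat \<Rightarrow> nat \<Rightarrow> real) \<Rightarrow> (nat \<Rightarrow> nat \<Rightarrow> real)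
    \<Rightarrow> bool" where
  "ratios_defined d \<pi> p M i h h' v u \<longleftrightarrow>
     (\<forall>j<M. p i h (v j) \<noteq> 0 \<and> p i h' (u j) \<noteq> 0) \<and>
     total_weight d \<pi> p M i h' u \<noteq> 0 \<and>
     \<pi> (Suc i) h' * total_weight d \<pi> p M i h v \<noteq> 0"

definition accept_prob ::
  "(nat \<Rightarrow> nat) \<Rightarrow> (nat \<Rightarrow> (nat \<Rightarrow> real) \<Rightarrow> real) \<Rightarrow> (nat \<Rightarrow> (nat \<Rightarrow> real) \<Rightarrow> (nat \<Rightarrow> real) \<Rightarrow> real)
    \<Rightarrow> nat \<Rightarrow> nat \<Rightarrow> (nat \<Rightarrow> real) \<Rightarrow> (nat \<Rightarrow> real) \<Rightarrow> (nat \<Rightarrow> nat \<Rightarrow> real) \<Rightarrow> (nat \<Rightarrow> nat \<Rightarrow> real)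
    \<Rightarrow> real" where
  "accept_prob d \<pi> p M i h h' v u =
     min 1 ((\<pi> (Suc i) h * total_weight d \<pi> p M i h' u) /
            (\<pi> (Suc i) h' * total_weight d \<pi> p M i h v))"

definition swap_move ::
  "(nat \<Rightarrow> nat) \<Rightarrow> nat \<Rightarrow> (nat \<Rightarrow> nat \<Rightarrow> real) \<Rightarrow> (nat \<Rightarrow> real) \<Rightarrow> (nat \<Rightarrow> nat \<Rightarrow> real)" where
  "swap_move d i x t =
     x(i := merge (hat_ix d i) (tilde_ix d i) (x (Suc i), t), Suc i := restrict (x i) (hat_ix d i))"

definition swap_kernel ::
  "nat \<Rightarrow> (nat \<Rightarrow> nat) \<Rightarrow> (nat \<Rightarrow> (nat \<Rightarrow> real) \<Rightarrow> real)
    \<Rightarrow> (nat \<Rightarrow> (nat \<Rightarrow> real) \<Rightarrow> (nat \<Rightarrow> real) \<Rightarrow> real) \<Rightarrow> nat \<Rightarrow> nat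
    \<Rightarrow> (nat \<Rightarrow> nat \<Rightarrow> real) \<Rightarrow> (nat \<Rightarrow> nat \<Rightarrow> real) measure" where
  "swap_kernel L d \<pi> p M i x =
    (let h = restrict (x i) (hat_ix d i);
         t = restrict (x i) (tilde_ix d i);
         h' = x (Suc i)
     in do {
       v' \<leftarrow> \<Pi>\<^sub>M j\<in>{1..<M}. density (euclid (tilde_ix d i)) (\<lambda>s. ennreal (p i h s));
       u \<leftarrow> \<Pi>\<^sub>M j\<in>{..<M}. density (euclid (tilde_ix d i)) (\<lambda>s. ennreal (p i h' s));
       let v = v'(0 := t);
       if ratios_defined d \<pi> p M i h h' v u then do {
         j \<leftarrow> point_measure {..<M}
                (\<lambda>j. ennreal (weight d \<pi> p i h' (u j) / total_weight d \<pi> p M i h' u));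
         accept \<leftarrow> measure_pmf (bernoulli_pmf (accept_prob d \<pi> p M i h h' v u));
         return (state_space L d) (if accept then swap_move d i x (u j) else x)
       }
       else return (state_space L d) x
     })"

text \<open>
  The two measures on pairs \<open>(x, y)\<close> are \<open>\<mu>(dx) K(x, dy)\<close> and \<open>\<mu>(dy) K(y, dx)\<close>.
\<close>

definition detailed_balance :: "'a measure \<Rightarrow> ('a \<Rightarrow> 'a measure) \<Rightarrow> bool" where
  "detailed_balance \<mu> K \<longleftrightarrow>
     do { x \<leftarrow> \<mu>; y \<leftarrow> K x; return (\<mu> \<Otimes>\<^sub>M \<mu>) (x, y) } =
     do { y \<leftarrow> \<mu>; x \<leftarrow> K y; return (\<mu> \<Otimes>\<^sub>M \<mu>) (x, y) }"

end

theory Submission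
  imports Defs
begin

text \<open>
  Write \<open>h\<close> and \<open>t\<close> for the hat and tilde part of \<open>x\<^sub>i\<close>, \<open>h'\<close> for \<open>x\<^sub>i\<^sub>+\<^sub>1\<close>, \<open>f h t\<close> for the density
  \<open>\<pi>\<^sub>i\<close> and \<open>g\<close> for \<open>\<pi>\<^sub>i\<^sub>+\<^sub>1\<close>. Staying at \<open>x\<close> contributes a measure on the diagonal, which is
  symmetric for any kernel. Only the accepted moves
  \<open>(h, t, h') \<rightarrow> (h', u\<^sup>j, h)\<close> have to be balanced, and they leave the levels other than
  \<open>i\<close> and \<open>i + 1\<close> unchanged.

  Where \<open>q h t \<noteq> 0\<close>, the target density is \<open>f h t = w h t * q h t\<close>. Hence the current tilde part
  together with the \<open>M - 1\<close> auxiliary draws is a pool \<open>v\<close> of \<open>M\<close> independent draws from \<open>q h\<close>,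
  reweighted by \<open>w h (v 0)\<close>; where \<open>q h t = 0\<close> the move is rejected
  (lemma \<open>nn_integral_complete_pool\<close>). After this change of measure the draws \<open>v\<close> and \<open>u\<close> enter in
  the same way. The factor
  \<open>g h' * (w h' (u j) / W h' u) * min 1 (g h * W h' u / (g h' * W h v))\<close>
  equals \<open>w h' (u j) * min (g h / W h v) (g h' / W h' u)\<close> when no denominator vanishes, and the
  minimum, called \<open>swap_rate\<close> and set to \<open>0\<close> where it is undefined, is
  invariant under exchanging \<open>(h, v)\<close> with \<open>(h', u)\<close> and under permuting the members of a pool. By the
  second invariance the selected index \<open>j\<close> may be taken to be \<open>0\<close>, so the flow of accepted moves
  has the density
  \<open>M * w h (v 0) * w h' (u 0) * swap_rate h v h' u\<close> with respect to the two pools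
  (lemma \<open>nn_integral_flux\<close>). By the first invariance and Fubini this flow is its own reversal
  (theorem \<open>flux_balance\<close>).

  The computation is carried out for abstract measures \<open>H\<close> and \<open>T\<close> carrying the hat and tilde parts,
  and is then transported to the product space by integrating out the coordinates one at a time.
\<close>

section \<open>Products of kernels and of densities\<close>

text \<open>
  The boxes generate the product \<open>\<sigma>\<close>-algebra and are closed under intersection, and the measure
  of a box is a finite product of measurable functions of the parameter.
\<close>

lemma measurable_PiM_kernel:
  assumes I: "finite I" and K[measurable]: "K \<in> N \<rightarrow>\<^sub>M prob_algebra T"
  shows "(\<lambda>x. \<Pi>\<^sub>M i\<in>I. K x) \<in> N \<rightarrow>\<^sub>M prob_algebra (\<Pi>\<^sub>M i\<in>I. T)"
proof (rule measurable_prob_algebra_generated)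
  have Kx: "prob_space (K x)" "sets (K x) = sets T" if "x \<in> space N" for x
    using measurable_space[OF K that] by (auto simp: space_prob_algebra)
  let ?G = "{Pi\<^sub>E I E |E. \<forall>i\<in>I. E i \<in> sets T}"
  have "prod_algebra I (\<lambda>_. T) = ?G"
    using I by (auto simp: prod_algebra_eq_finite)
  then show "sets (\<Pi>\<^sub>M i\<in>I. T) = sigma_sets (\<Pi>\<^sub>E i\<in>I. space T) ?G"
    by (simp add: sets_PiM)
  show "Int_stable ?G"
    using Int_stable_PiE[of I I "\<lambda>_. T"] by simp
  show "?G \<subseteq> Pow (\<Pi>\<^sub>E i\<in>I. space T)"
    by (auto simp: PiE_iff) (meson sets.sets_into_space subsetD)
  fix x assume x: "x \<in> space N"
  show "prob_space (\<Pi>\<^sub>M i\<in>I. K x)"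
    by (intro prob_space_PiM Kx x)
  show "sets (\<Pi>\<^sub>M i\<in>I. K x) = sets (\<Pi>\<^sub>M i\<in>I. T)"
    by (intro sets_PiM_cong Kx x refl)
next
  have Kx: "prob_space (K x)" "sets (K x) = sets T" if "x \<in> space N" for x
    using measurable_space[OF K that] by (auto simp: space_prob_algebra)
  fix A assume "A \<in> {Pi\<^sub>E I E |E. \<forall>i\<in>I. E i \<in> sets T}"
  then obtain E where A: "A = Pi\<^sub>E I E" and E[measurable]: "\<And>i. i \<in> I \<Longrightarrow> E i \<in> sets T"
    by auto
  note [measurable] = measurable_prob_algebraD[OF K]
  have "emeasure (\<Pi>\<^sub>M i\<in>I. K x) A = (\<Prod>i\<in>I. emeasure (K x) (E i))" if x: "x \<in> space N" for x
  proof -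
    interpret product_prob_space "\<lambda>_. K x" I
      using Kx[OF x] by (simp add: product_prob_space_def product_sigma_finite_def
        product_prob_space_axioms_def prob_space_imp_sigma_finite)
    show ?thesis
      unfolding A using I E Kx[OF x] by (subst emeasure_PiM) auto
  qed
  then show "(\<lambda>x. emeasure (\<Pi>\<^sub>M i\<in>I. K x) A) \<in> borel_measurable N"
    by (subst measurable_cong) auto
qed

text \<open>
  The factors are identically distributed, so relabelling them leaves the product measure unchanged.
\<close>

lemma nn_integral_PiM_transpose:
  assumes Q: "prob_space Q" and a: "a \<in> I" and b: "b \<in> I"
    and F[measurable]: "F \<in> borel_measurable (\<Pi>\<^sub>M i\<in>I. Q)"
  shows "(\<integral>\<^sup>+u. F u \<partial>(\<Pi>\<^sub>M i\<in>I. Q)) = (\<integral>\<^sup>+u. F (\<lambda>n\<in>I. u (Transposition.transpose a b n)) \<partial>(\<Pi>\<^sub>M i\<in>I. Q))"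
proof -
  have maps: "Transposition.transpose a b \<in> I \<rightarrow> I"
    using a b by (auto simp: Transposition.transpose_def)
  have eq: "(\<Pi>\<^sub>M i\<in>I. Q) = distr (\<Pi>\<^sub>M i\<in>I. Q) (\<Pi>\<^sub>M i\<in>I. Q) (\<lambda>u. \<lambda>n\<in>I. u (Transposition.transpose a b n))"
    using distr_PiM_reindex[of I "\<lambda>_. Q" "Transposition.transpose a b" I] Q maps
    by (simp add: inj_on_subset[OF inj_transpose])
  have [measurable]: "(\<lambda>u. \<lambda>n\<in>I. u (Transposition.transpose a b n)) \<in> (\<Pi>\<^sub>M i\<in>I. Q) \<rightarrow>\<^sub>M (\<Pi>\<^sub>M i\<in>I. Q)"
    using maps by (intro measurable_restrict measurable_component_singleton) auto
  show ?thesis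
    by (subst eq, subst nn_integral_distr) auto
qed

lemma (in product_sigma_finite) product_nn_integral_insert2:
  assumes J: "finite J" "i \<notin> insert k J" "k \<notin> J"
    and F: "F \<in> borel_measurable (Pi\<^sub>M (insert i (insert k J)) M)"
  shows "integral\<^sup>N (Pi\<^sub>M (insert i (insert k J)) M) F =
    (\<integral>\<^sup>+r. \<integral>\<^sup>+b. \<integral>\<^sup>+a. F (r(k := b, i := a)) \<partial>M i \<partial>M k \<partial>Pi\<^sub>M J M)"
proof -
  have "(\<lambda>(x, a). x(i := a)) \<in> Pi\<^sub>M (insert k J) M \<Otimes>\<^sub>M M i \<rightarrow>\<^sub>M Pi\<^sub>M (insert i (insert k J)) M"
    by (rule measurable_add_dim)
  from measurable_compose[OF this F]
  have "(\<lambda>x. \<integral>\<^sup>+a. F (x(i := a)) \<partial>M i) \<in> borel_measurable (Pi\<^sub>M (insert k J) M)"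
    by (intro sigma_finite_measure.borel_measurable_nn_integral[OF sigma_finite_measures])
       (simp add: split_beta')
  from product_nn_integral_insert[OF J(1,3) this] show ?thesis
    using product_nn_integral_insert[OF _ J(2) F] J(1) by simp
qed

section \<open>Pools of weighted tries\<close>

text \<open>
  Abstract form of one swap: \<open>H\<close> carries the hat parts and \<open>T\<close> the tilde parts, \<open>f\<close> is the
  density of level \<open>i\<close>, \<open>g\<close> that of level \<open>i + 1\<close>, and \<open>q h\<close> the reference conditional density.
\<close>

locale try_pool =
  fixes H :: "'h measure" and T :: "'t measure"
    and f q :: "'h \<Rightarrow> 't \<Rightarrow> real" and g :: "'h \<Rightarrow> real" and M :: nat
  assumes sigma_finite_H: "sigma_finite_measure H" and sigma_finite_T: "sigma_finite_measure T"
    and f_measurable: "case_prod f \<in> borel_measurable (H \<Otimes>\<^sub>M T)"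
    and q_measurable: "case_prod q \<in> borel_measurable (H \<Otimes>\<^sub>M T)"
    and g_measurable[measurable]: "g \<in> borel_measurable H"
    and f_nonneg: "h \<in> space H \<Longrightarrow> t \<in> space T \<Longrightarrow> 0 \<le> f h t"
    and q_nonneg: "h \<in> space H \<Longrightarrow> t \<in> space T \<Longrightarrow> 0 \<le> q h t"
    and g_nonneg: "h \<in> space H \<Longrightarrow> 0 \<le> g h"
    and q_prob: "h \<in> space H \<Longrightarrow> (\<integral>\<^sup>+t. ennreal (q h t) \<partial>T) = 1"
    and M_pos: "0 < M"
begin

abbreviation tries :: "nat set \<Rightarrow> (nat \<Rightarrow> 't) measure" where
  "tries I \<equiv> \<Pi>\<^sub>M j\<in>I. T"

definition proposal :: "'h \<Rightarrow> 't measure" where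
  "proposal h = density T (\<lambda>t. ennreal (q h t))"

abbreviation sample :: "nat set \<Rightarrow> 'h \<Rightarrow> (nat \<Rightarrow> 't) measure" where
  "sample I h \<equiv> \<Pi>\<^sub>M j\<in>I. proposal h"

definition w :: "'h \<Rightarrow> 't \<Rightarrow> real" where
  "w h t = f h t / q h t"

definition W :: "'h \<Rightarrow> (nat \<Rightarrow> 't) \<Rightarrow> real" where
  "W h v = (\<Sum>j<M. w h (v j))"

text \<open>
  No denominator of the acceptance ratio vanishes, where \<open>v\<close> is the pool of the current state and \<open>u\<close>
  the proposed pool. The condition is not symmetric in the two: it requires \<open>g h' \<noteq> 0\<close>, but
  not \<open>g h \<noteq> 0\<close>.
\<close>

definition ok :: "'h \<Rightarrow> 'h \<Rightarrow> (nat \<Rightarrow> 't) \<Rightarrow> (nat \<Rightarrow> 't) \<Rightarrow> bool" where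
  "ok h h' v u \<longleftrightarrow> (\<forall>j<M. q h (v j) \<noteq> 0 \<and> q h' (u j) \<noteq> 0) \<and> W h' u \<noteq> 0 \<and> g h' * W h v \<noteq> 0"

definition acc :: "'h \<Rightarrow> 'h \<Rightarrow> (nat \<Rightarrow> 't) \<Rightarrow> (nat \<Rightarrow> 't) \<Rightarrow> real" where
  "acc h h' v u = min 1 ((g h * W h' u) / (g h' * W h v))"

lemma f_measurable'[measurable (raw)]:
  "a \<in> N \<rightarrow>\<^sub>M H \<Longrightarrow> b \<in> N \<rightarrow>\<^sub>M T \<Longrightarrow> (\<lambda>x. f (a x) (b x)) \<in> borel_measurable N"
  using measurable_compose[OF measurable_Pair[of a N H b T] f_measurable] by (simp only: prod.case)

lemma q_measurable'[measurable (raw)]: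
  "a \<in> N \<rightarrow>\<^sub>M H \<Longrightarrow> b \<in> N \<rightarrow>\<^sub>M T \<Longrightarrow> (\<lambda>x. q (a x) (b x)) \<in> borel_measurable N"
  using measurable_compose[OF measurable_Pair[of a N H b T] q_measurable] by (simp only: prod.case)

lemma w_measurable[measurable (raw)]:
  assumes [measurable]: "a \<in> N \<rightarrow>\<^sub>M H" "b \<in> N \<rightarrow>\<^sub>M T"
  shows "(\<lambda>x. w (a x) (b x)) \<in> borel_measurable N"
  unfolding w_def by measurable

lemma W_measurable[measurable (raw)]:
  assumes [measurable]: "a \<in> N \<rightarrow>\<^sub>M H" "b \<in> N \<rightarrow>\<^sub>M tries {..<M}"
  shows "(\<lambda>x. W (a x) (b x)) \<in> borel_measurable N"
  unfolding W_def by measurable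

lemma all_q_measurable[measurable (raw)]:
  assumes [measurable]: "a \<in> N \<rightarrow>\<^sub>M H" "b \<in> N \<rightarrow>\<^sub>M tries {..<M}"
  shows "Measurable.pred N (\<lambda>x. \<forall>j<M. q (a x) (b x j) \<noteq> 0)"
proof -
  have "Measurable.pred N (\<lambda>x. \<forall>j\<in>{..<M}. q (a x) (b x j) \<noteq> 0)"
    by measurable
  then show ?thesis by (simp add: Ball_def)
qed

lemma ok_measurable[measurable (raw)]:
  assumes [measurable]: "a \<in> N \<rightarrow>\<^sub>M H" "a' \<in> N \<rightarrow>\<^sub>M H" "b \<in> N \<rightarrow>\<^sub>M tries {..<M}" "c \<in> N \<rightarrow>\<^sub>M tries {..<M}"
  shows "Measurable.pred N (\<lambda>x. ok (a x) (a' x) (b x) (c x))"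
  unfolding ok_def all_conj_distrib imp_conjR by measurable

lemma acc_measurable[measurable (raw)]:
  assumes [measurable]: "a \<in> N \<rightarrow>\<^sub>M H" "a' \<in> N \<rightarrow>\<^sub>M H" "b \<in> N \<rightarrow>\<^sub>M tries {..<M}" "c \<in> N \<rightarrow>\<^sub>M tries {..<M}"
  shows "(\<lambda>x. acc (a x) (a' x) (b x) (c x)) \<in> borel_measurable N"
  unfolding acc_def by measurable

lemma w_nonneg: "h \<in> space H \<Longrightarrow> t \<in> space T \<Longrightarrow> 0 \<le> w h t"
  by (simp add: w_def f_nonneg q_nonneg)

lemma tries_component: "v \<in> space (tries I) \<Longrightarrow> j \<in> I \<Longrightarrow> v j \<in> space T"
  by (auto simp: space_PiM PiE_iff)

lemma W_nonneg: "h \<in> space H \<Longrightarrow> v \<in> space (tries {..<M}) \<Longrightarrow> 0 \<le> W h v"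
  unfolding W_def by (intro sum_nonneg w_nonneg tries_component) auto

lemma acc_nonneg:
  "h \<in> space H \<Longrightarrow> h' \<in> space H \<Longrightarrow> v \<in> space (tries {..<M}) \<Longrightarrow> u \<in> space (tries {..<M}) \<Longrightarrow>
    0 \<le> acc h h' v u"
  by (simp add: acc_def g_nonneg W_nonneg)

lemma acc_le_1: "acc h h' v u \<le> 1"
  by (simp add: acc_def)

lemma tries_eq_insert: "{..<M} = insert 0 {1..<M}"
  using M_pos by auto

lemma tries_update[measurable (raw)]:
  assumes "v \<in> N \<rightarrow>\<^sub>M tries {1..<M}" and "t \<in> N \<rightarrow>\<^sub>M T"
  shows "(\<lambda>x. (v x)(0 := t x)) \<in> N \<rightarrow>\<^sub>M tries {..<M}"
  by (rule measurable_fun_upd[OF _ assms]) (use M_pos in auto)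

lemma proposal_kernel: "proposal \<in> H \<rightarrow>\<^sub>M prob_algebra T"
proof (rule measurable_prob_algebraI)
  interpret T: sigma_finite_measure T by (rule sigma_finite_T)
  show prob: "prob_space (proposal h)" if "h \<in> space H" for h
    using that q_prob by (intro prob_spaceI) (simp add: proposal_def emeasure_density cong: nn_integral_cong)
  show "proposal \<in> H \<rightarrow>\<^sub>M subprob_algebra T"
  proof (rule measurable_subprob_algebra)
    show "subprob_space (proposal h)" if "h \<in> space H" for h
      by (rule prob_space_imp_subprob_space[OF prob[OF that]])
    show "sets (proposal h) = sets T" for h
      by (simp add: proposal_def)
    fix A assume [measurable]: "A \<in> sets T"
    have "(\<lambda>h. \<integral>\<^sup>+t. ennreal (q h t) * indicator A t \<partial>T) \<in> borel_measurable H"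
      by measurable
    then show "(\<lambda>h. emeasure (proposal h) A) \<in> borel_measurable H"
      by (rule measurable_cong[THEN iffD1, rotated]) (simp add: proposal_def emeasure_density)
  qed
qed

lemma sample_kernel: "finite I \<Longrightarrow> sample I \<in> H \<rightarrow>\<^sub>M prob_algebra (tries I)"
  by (rule measurable_PiM_kernel[OF _ proposal_kernel])

lemma prob_space_proposal: "h \<in> space H \<Longrightarrow> prob_space (proposal h)"
  and sets_proposal[measurable_cong, simp]: "sets (proposal h) = sets T"
  and space_proposal[simp]: "space (proposal h) = space T"
  using measurable_space[OF proposal_kernel, of h] by (auto simp: space_prob_algebra proposal_def)

lemma sets_sample[measurable_cong]: "sets (sample I h) = sets (tries I)"
  by (intro sets_PiM_cong) auto

lemma space_sample[simp]: "space (sample I h) = space (tries I)"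
  by (rule sets_eq_imp_space_eq[OF sets_sample])

lemma prob_space_sample: "h \<in> space H \<Longrightarrow> prob_space (sample I h)"
  by (intro prob_space_PiM prob_space_proposal)

lemma nn_integral_sample_measurable[measurable (raw)]:
  assumes "finite I" and a: "a \<in> N \<rightarrow>\<^sub>M H" and F: "case_prod F \<in> borel_measurable (N \<Otimes>\<^sub>M tries I)"
  shows "(\<lambda>x. \<integral>\<^sup>+v. F x v \<partial>sample I (a x)) \<in> borel_measurable N"
  by (rule nn_integral_measurable_subprob_algebra2[OF F])
     (rule measurable_compose[OF a measurable_prob_algebraD[OF sample_kernel[OF assms(1)]]])

text \<open>
  The current tilde part has the unnormalized density \<open>f h\<close>, the others are drawn
  from \<open>q h\<close>. Since \<open>f h t = w h t * q h t\<close> wherever \<open>q h t \<noteq> 0\<close>, the weight turns the current part into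
  one more draw, provided that the integrand ignores the points with \<open>q h t = 0\<close>, where \<open>f h\<close> may
  still have mass.
\<close>

lemma nn_integral_complete_pool:
  assumes h: "h \<in> space H" and F[measurable]: "F \<in> borel_measurable (tries {..<M})"
    and zero: "\<And>v. v \<in> space (tries {..<M}) \<Longrightarrow> q h (v 0) = 0 \<Longrightarrow> F v = 0"
  shows "(\<integral>\<^sup>+t. ennreal (f h t) * (\<integral>\<^sup>+v. F (v(0 := t)) \<partial>sample {1..<M} h) \<partial>T) =
    (\<integral>\<^sup>+v. ennreal (w h (v 0)) * F v \<partial>sample {..<M} h)"
proof -
  interpret product_prob_space "\<lambda>_::nat. proposal h" UNIV
    using prob_space_proposal[OF h] by (simp add: product_prob_space_def product_sigma_finite_def
        product_prob_space_axioms_def prob_space_imp_sigma_finite)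
  have [measurable]: "(\<lambda>x. h) \<in> N \<rightarrow>\<^sub>M H" for N :: "'a measure"
    using h by simp
  have [measurable]: "(\<lambda>v. v 0) \<in> tries {..<M} \<rightarrow>\<^sub>M T"
    using M_pos by (intro measurable_component_singleton) simp
  have upd: "v(0 := t) \<in> space (tries {..<M})" if "v \<in> space (tries {1..<M})" "t \<in> space T" for v t
    using that M_pos by (auto simp: space_PiM PiE_iff extensional_def)
  have upd_m: "(\<lambda>v. v(0 := t)) \<in> tries {1..<M} \<rightarrow>\<^sub>M tries {..<M}" if "t \<in> space T" for t
    using that by measurable
  have "(\<integral>\<^sup>+v. ennreal (w h (v 0)) * F v \<partial>sample {..<M} h)
      = (\<integral>\<^sup>+t. (\<integral>\<^sup>+v. ennreal (w h t) * F (v(0 := t)) \<partial>sample {1..<M} h) \<partial>proposal h)"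
    using product_nn_integral_insert_rev[of "{1..<M}" 0 "\<lambda>v. ennreal (w h (v 0)) * F v",
        folded tries_eq_insert] by simp
  also have "\<dots> = (\<integral>\<^sup>+t. ennreal (w h t) * (\<integral>\<^sup>+v. F (v(0 := t)) \<partial>sample {1..<M} h) \<partial>proposal h)"
    using measurable_compose[OF upd_m F]
    by (intro nn_integral_cong nn_integral_cmult) simp
  also have "\<dots> = (\<integral>\<^sup>+t. ennreal (q h t) * (ennreal (w h t) * (\<integral>\<^sup>+v. F (v(0 := t)) \<partial>sample {1..<M} h)) \<partial>T)"
    unfolding proposal_def[of h, THEN arg_cong, of "\<lambda>N. nn_integral N X" for X]
    by (rule nn_integral_density) (measurable, use h in measurable)
  also have "\<dots> = (\<integral>\<^sup>+t. ennreal (f h t) * (\<integral>\<^sup>+v. F (v(0 := t)) \<partial>sample {1..<M} h) \<partial>T)"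
  proof (rule nn_integral_cong)
    fix t assume t: "t \<in> space T"
    show "ennreal (q h t) * (ennreal (w h t) * (\<integral>\<^sup>+v. F (v(0 := t)) \<partial>sample {1..<M} h))
      = ennreal (f h t) * (\<integral>\<^sup>+v. F (v(0 := t)) \<partial>sample {1..<M} h)"
    proof (cases "q h t = 0")
      case True
      have "(\<integral>\<^sup>+v. F (v(0 := t)) \<partial>sample {1..<M} h) = (\<integral>\<^sup>+v. 0 \<partial>sample {1..<M} h)"
        by (intro nn_integral_cong zero upd) (use t True in auto)
      then show ?thesis by simp
    next
      case False
      then have "ennreal (q h t) * ennreal (w h t) = ennreal (f h t)"
        using q_nonneg[OF h t] by (subst ennreal_mult'[symmetric]) (auto simp: w_def)
      then show ?thesis by (simp add: mult.assoc[symmetric])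
    qed
  qed
  finally show ?thesis by simp
qed

section \<open>Reversibility of the accepted moves\<close>

text \<open>
  The expected value of \<open>\<phi>\<close> at the new tilde part, restricted to the event that the move
  from \<open>(h, t, h')\<close> is accepted.
\<close>

definition flux :: "'h \<Rightarrow> 't \<Rightarrow> 'h \<Rightarrow> ('t \<Rightarrow> ennreal) \<Rightarrow> ennreal" where
  "flux h t h' \<phi> =
    (\<integral>\<^sup>+v'. \<integral>\<^sup>+u. (if ok h h' (v'(0 := t)) u
        then \<Sum>j<M. ennreal (w h' (u j) / W h' u * acc h h' (v'(0 := t)) u) * \<phi> (u j) else 0)
      \<partial>sample {..<M} h' \<partial>sample {1..<M} h)"

text \<open>
  The common factor of the forward and the backward flow between the pools \<open>v\<close> over \<open>h\<close> and \<open>u\<close>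
  over \<open>h'\<close>, with the weights of the current and the selected try split off.
\<close>

definition swap_rate :: "'h \<Rightarrow> (nat \<Rightarrow> 't) \<Rightarrow> 'h \<Rightarrow> (nat \<Rightarrow> 't) \<Rightarrow> real" where
  "swap_rate h v h' u =
    (if (\<forall>j<M. q h (v j) \<noteq> 0) \<and> (\<forall>j<M. q h' (u j) \<noteq> 0) \<and> W h v \<noteq> 0 \<and> W h' u \<noteq> 0
     then min (g h / W h v) (g h' / W h' u) else 0)"

lemma swap_rate_commute: "swap_rate h v h' u = swap_rate h' u h v"
  unfolding swap_rate_def by (auto simp: min.commute)

lemma swap_rate_permute:
  assumes "a < M" "b < M"
  shows "swap_rate h v h' (\<lambda>n\<in>{..<M}. u (Transposition.transpose a b n)) = swap_rate h v h' u"
proof -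
  have bij: "bij_betw (Transposition.transpose a b) {..<M} {..<M}"
    using assms by (intro bij_betw_byWitness[where f' = "Transposition.transpose a b"])
      (auto simp: Transposition.transpose_def)
  have "W h' (\<lambda>n\<in>{..<M}. u (Transposition.transpose a b n)) = W h' u"
    unfolding W_def using sum.reindex_bij_betw[OF bij, of "\<lambda>j. w h' (u j)"] by simp
  moreover have "(\<forall>j<M. q h' ((\<lambda>n\<in>{..<M}. u (Transposition.transpose a b n)) j) \<noteq> 0) \<longleftrightarrow>
      (\<forall>j<M. q h' (u j) \<noteq> 0)"
    using Set.ball_simps(9)[of "Transposition.transpose a b" "{..<M}" "\<lambda>j. q h' (u j) \<noteq> 0"]
    unfolding bij_betw_imp_surj_on[OF bij] by (simp add: Ball_def)
  ultimately show ?thesis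
    by (simp only: swap_rate_def)
qed

lemma swap_rate_measurable[measurable (raw)]:
  assumes [measurable]: "a \<in> N \<rightarrow>\<^sub>M H" "a' \<in> N \<rightarrow>\<^sub>M H" "b \<in> N \<rightarrow>\<^sub>M tries {..<M}" "c \<in> N \<rightarrow>\<^sub>M tries {..<M}"
  shows "(\<lambda>x. swap_rate (a x) (b x) (a' x) (c x)) \<in> borel_measurable N"
  unfolding swap_rate_def by measurable

text \<open>
  This is the Metropolis--Hastings cancellation. The asymmetry of \<open>ok\<close> disappears here, because
  the minimum is zero as soon as \<open>g h\<close> or \<open>g h'\<close> vanishes.
\<close>

lemma weighted_acceptance_eq_swap_rate:
  assumes h: "h \<in> space H" "h' \<in> space H"
    and v: "v \<in> space (tries {..<M})" and u: "u \<in> space (tries {..<M})" and j: "j < M"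
  shows "g h' * (if ok h h' v u then w h' (u j) / W h' u * acc h h' v u else 0) =
    swap_rate h v h' u * w h' (u j)"
proof (cases "ok h h' v u")
  case True
  then have pos: "0 < g h'" "0 < W h' u" "0 < W h v"
    using g_nonneg[OF h(2)] W_nonneg[OF h(2) u] W_nonneg[OF h(1) v] by (auto simp: ok_def less_le)
  have "g h' / W h' u * acc h h' v u = min (g h / W h v) (g h' / W h' u)"
    unfolding acc_def using pos by (subst min_mult_distrib_left) (auto simp: field_simps min.commute)
  moreover have "swap_rate h v h' u = min (g h / W h v) (g h' / W h' u)"
    using True by (auto simp: ok_def swap_rate_def)
  moreover have "g h' * (w h' (u j) / W h' u * acc h h' v u) = g h' / W h' u * acc h h' v u * w h' (u j)"
    by simp
  ultimately show ?thesis
    using True by simp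
next
  case False
  then have "g h' = 0 \<or> swap_rate h v h' u = 0"
    by (auto simp: ok_def swap_rate_def)
  then have "swap_rate h v h' u = 0"
    using divide_nonneg_nonneg[OF g_nonneg[OF h(1)] W_nonneg[OF h(1) v]]
    by (auto simp: swap_rate_def min_def)
  with False show ?thesis by simp
qed

text \<open>
  Relabelling the pool \<open>u\<close> changes neither its law nor the swap rate, so all selected indices
  contribute equally.
\<close>

lemma nn_integral_choose_first:
  assumes h: "h \<in> space H" "h' \<in> space H" and v: "v \<in> space (tries {..<M})" and j: "j < M"
    and \<phi>[measurable]: "\<phi> \<in> borel_measurable T"
  shows "(\<integral>\<^sup>+u. ennreal (swap_rate h v h' u * w h' (u j)) * \<phi> (u j) \<partial>sample {..<M} h') =
    (\<integral>\<^sup>+u. ennreal (swap_rate h v h' u * w h' (u 0)) * \<phi> (u 0) \<partial>sample {..<M} h')"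
proof -
  let ?F = "\<lambda>u. ennreal (swap_rate h v h' u * w h' (u j)) * \<phi> (u j)"
  have [measurable]: "(\<lambda>u. u j) \<in> tries {..<M} \<rightarrow>\<^sub>M T"
    using j by (intro measurable_component_singleton) simp
  have "?F \<in> borel_measurable (tries {..<M})"
    using h v by measurable
  then have "?F \<in> borel_measurable (sample {..<M} h')"
    by (simp cong: measurable_cong_sets add: measurable_cong_sets[OF sets_sample refl])
  from nn_integral_PiM_transpose[OF prob_space_proposal[OF h(2)] _ _ this, of 0 j] j M_pos
  show ?thesis
    by (simp add: swap_rate_permute)
qed

text \<open>
  In terms of the two completed pools the accepted flow has a density in which \<open>(h, v)\<close> and \<open>(h', u)\<close>
  play the same role; the factor \<open>M\<close> counts the possible choices of the selected try.
\<close>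

lemma nn_integral_flux:
  assumes h: "h \<in> space H" and h': "h' \<in> space H"
    and G[measurable]: "case_prod G \<in> borel_measurable (T \<Otimes>\<^sub>M T)"
  shows "(\<integral>\<^sup>+t. ennreal (f h t * g h') * flux h t h' (G t) \<partial>T) =
    (\<integral>\<^sup>+v. \<integral>\<^sup>+u. of_nat M * (ennreal (w h (v 0) * w h' (u 0) * swap_rate h v h' u) * G (v 0) (u 0))
      \<partial>sample {..<M} h' \<partial>sample {..<M} h)"
proof -
  have comp[measurable]: "(\<lambda>v. v j) \<in> tries {..<M} \<rightarrow>\<^sub>M T" if "j < M" for j
    using that by (intro measurable_component_singleton) simp
  note [measurable] = h h' comp[OF M_pos]
  define move where "move v u j =
    ennreal (if ok h h' v u then w h' (u j) / W h' u * acc h h' v u else 0) * G (v 0) (u j)"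
    for v u :: "nat \<Rightarrow> 't" and j :: nat
  have move_pair[measurable]: "(\<lambda>x. move (fst x) (snd x) j) \<in> borel_measurable (tries {..<M} \<Otimes>\<^sub>M tries {..<M})"
    if "j < M" for j
    unfolding move_def using that by measurable
  define F where "F v = (\<integral>\<^sup>+u. (\<Sum>j<M. move v u j) \<partial>sample {..<M} h')" for v
  have F[measurable]: "F \<in> borel_measurable (tries {..<M})"
    unfolding F_def by measurable
  have "(\<integral>\<^sup>+t. ennreal (f h t * g h') * flux h t h' (G t) \<partial>T)
    = (\<integral>\<^sup>+t. ennreal (f h t) * (\<integral>\<^sup>+v. ennreal (g h') * F (v(0 := t)) \<partial>sample {1..<M} h) \<partial>T)"
  proof (rule nn_integral_cong)
    fix t assume t[measurable]: "t \<in> space T"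
    have "flux h t h' (G t) = (\<integral>\<^sup>+v. F (v(0 := t)) \<partial>sample {1..<M} h)"
      unfolding flux_def F_def move_def by (intro nn_integral_cong) auto
    moreover have "(\<lambda>v. F (v(0 := t))) \<in> borel_measurable (sample {1..<M} h)"
      by measurable
    ultimately show "ennreal (f h t * g h') * flux h t h' (G t) =
        ennreal (f h t) * (\<integral>\<^sup>+v. ennreal (g h') * F (v(0 := t)) \<partial>sample {1..<M} h)"
      using f_nonneg[OF h t] g_nonneg[OF h'] by (simp add: nn_integral_cmult ennreal_mult mult.assoc)
  qed
  also have "\<dots> = (\<integral>\<^sup>+v. ennreal (w h (v 0)) * (ennreal (g h') * F v) \<partial>sample {..<M} h)"
  proof (rule nn_integral_complete_pool[OF h])
    fix v :: "nat \<Rightarrow> 't" assume "q h (v 0) = 0"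
    then have "\<not> ok h h' v u" for u
      using M_pos by (auto simp: ok_def)
    then show "ennreal (g h') * F v = 0"
      by (simp add: F_def move_def)
  qed measurable
  also have "\<dots> = (\<integral>\<^sup>+v. \<integral>\<^sup>+u. of_nat M *
      (ennreal (w h (v 0) * w h' (u 0) * swap_rate h v h' u) * G (v 0) (u 0))
      \<partial>sample {..<M} h' \<partial>sample {..<M} h)"
  proof (rule nn_integral_cong)
    fix v assume "v \<in> space (sample {..<M} h)"
    then have v[measurable]: "v \<in> space (tries {..<M})" by simp
    then have v0[measurable]: "v 0 \<in> space T"
      using M_pos by (auto intro: tries_component)
    have [measurable]: "(\<lambda>u. move v u j) \<in> borel_measurable (tries {..<M})" if "j < M" for j
      using measurable_Pair2[OF move_pair[OF that] v] by simp
    have "ennreal (g h') * F v = (\<integral>\<^sup>+u. ennreal (g h') * (\<Sum>j<M. move v u j) \<partial>sample {..<M} h')"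
      unfolding F_def by (rule nn_integral_cmult[symmetric]) measurable
    also have "\<dots> = (\<integral>\<^sup>+u. (\<Sum>j<M. ennreal (swap_rate h v h' u * w h' (u j)) * G (v 0) (u j)) \<partial>sample {..<M} h')"
    proof (rule nn_integral_cong)
      fix u assume "u \<in> space (sample {..<M} h')"
      then have u: "u \<in> space (tries {..<M})" by simp
      have "ennreal (g h') * move v u j = ennreal (swap_rate h v h' u * w h' (u j)) * G (v 0) (u j)"
        if "j < M" for j
        unfolding move_def weighted_acceptance_eq_swap_rate[OF h h' v u that, symmetric]
        using g_nonneg[OF h'] by (simp only: ennreal_mult' mult.assoc)
      then show "ennreal (g h') * (\<Sum>j<M. move v u j) =
          (\<Sum>j<M. ennreal (swap_rate h v h' u * w h' (u j)) * G (v 0) (u j))"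
        by (simp add: sum_distrib_left)
    qed
    also have "\<dots> = (\<Sum>j<M. \<integral>\<^sup>+u. ennreal (swap_rate h v h' u * w h' (u j)) * G (v 0) (u j) \<partial>sample {..<M} h')"
      by (rule nn_integral_sum) measurable
    also have "\<dots> = (\<Sum>j<M. \<integral>\<^sup>+u. ennreal (swap_rate h v h' u * w h' (u 0)) * G (v 0) (u 0) \<partial>sample {..<M} h')"
      by (intro sum.cong refl nn_integral_choose_first[OF h h' v]) (auto, measurable)
    also have "\<dots> = (\<integral>\<^sup>+u. of_nat M * (ennreal (swap_rate h v h' u * w h' (u 0)) * G (v 0) (u 0)) \<partial>sample {..<M} h')"
      by (subst nn_integral_cmult) auto
    finally have "ennreal (w h (v 0)) * (ennreal (g h') * F v) = ennreal (w h (v 0)) * \<dots>"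
      by simp
    also have "\<dots> = (\<integral>\<^sup>+u. ennreal (w h (v 0)) *
        (of_nat M * (ennreal (swap_rate h v h' u * w h' (u 0)) * G (v 0) (u 0))) \<partial>sample {..<M} h')"
      by (rule nn_integral_cmult[symmetric]) measurable
    also have "\<dots> = (\<integral>\<^sup>+u. of_nat M * (ennreal (w h (v 0) * w h' (u 0) * swap_rate h v h' u) * G (v 0) (u 0))
      \<partial>sample {..<M} h')"
      using w_nonneg[OF h v0] by (intro nn_integral_cong) (simp add: ennreal_mult' mult_ac)
    finally show "ennreal (w h (v 0)) * (ennreal (g h') * F v) =
      (\<integral>\<^sup>+u. of_nat M * (ennreal (w h (v 0) * w h' (u 0) * swap_rate h v h' u) * G (v 0) (u 0))
      \<partial>sample {..<M} h')" .
  qed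
  finally show ?thesis .
qed

text \<open>
  Exchanging the roles of \<open>(h, v)\<close> and \<open>(h', u)\<close> in the symmetric density of the previous lemma
  reverses the move; the two orders of integration agree by Fubini's theorem.
\<close>

theorem flux_balance:
  fixes G :: "'h \<Rightarrow> 't \<Rightarrow> 'h \<Rightarrow> 't \<Rightarrow> ennreal"
  assumes G: "(\<lambda>(h, t, h', s). G h t h' s) \<in> borel_measurable (H \<Otimes>\<^sub>M T \<Otimes>\<^sub>M H \<Otimes>\<^sub>M T)"
  shows "(\<integral>\<^sup>+h'. \<integral>\<^sup>+h. \<integral>\<^sup>+t. ennreal (f h t * g h') * flux h t h' (\<lambda>s. G h t h' s) \<partial>T \<partial>H \<partial>H) =
    (\<integral>\<^sup>+h'. \<integral>\<^sup>+h. \<integral>\<^sup>+t. ennreal (f h t * g h') * flux h t h' (\<lambda>s. G h' s h t) \<partial>T \<partial>H \<partial>H)"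
proof -
  interpret HH: pair_sigma_finite H H
    by (intro pair_sigma_finite.intro sigma_finite_H)
  have G'[measurable (raw)]: "(\<lambda>x. G (a x) (b x) (a' x) (b' x)) \<in> borel_measurable N"
    if [measurable]: "a \<in> N \<rightarrow>\<^sub>M H" "b \<in> N \<rightarrow>\<^sub>M T" "a' \<in> N \<rightarrow>\<^sub>M H" "b' \<in> N \<rightarrow>\<^sub>M T"
    for a b a' b' and N :: "'x measure"
  proof -
    have "(\<lambda>x. (a x, b x, a' x, b' x)) \<in> N \<rightarrow>\<^sub>M H \<Otimes>\<^sub>M T \<Otimes>\<^sub>M H \<Otimes>\<^sub>M T"
      by measurable
    from measurable_compose[OF this G] show ?thesis by simp
  qed
  have [measurable]: "(\<lambda>v. v 0) \<in> tries {..<M} \<rightarrow>\<^sub>M T"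
    using M_pos by (intro measurable_component_singleton) simp
  define \<Phi> where "\<Phi> h v h' u =
    of_nat M * (ennreal (w h (v 0) * w h' (u 0) * swap_rate h v h' u) * G h (v 0) h' (u 0))" for h v h' u
  have \<Phi>[measurable (raw)]: "(\<lambda>x. \<Phi> (a x) (b x) (a' x) (b' x)) \<in> borel_measurable N"
    if [measurable]: "a \<in> N \<rightarrow>\<^sub>M H" "b \<in> N \<rightarrow>\<^sub>M tries {..<M}" "a' \<in> N \<rightarrow>\<^sub>M H" "b' \<in> N \<rightarrow>\<^sub>M tries {..<M}"
    for a b a' b' and N :: "'x measure"
    unfolding \<Phi>_def by measurable
  have "(\<integral>\<^sup>+h'. \<integral>\<^sup>+h. \<integral>\<^sup>+t. ennreal (f h t * g h') * flux h t h' (\<lambda>s. G h t h' s) \<partial>T \<partial>H \<partial>H) =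
    (\<integral>\<^sup>+h'. \<integral>\<^sup>+h. \<integral>\<^sup>+v. \<integral>\<^sup>+u. \<Phi> h v h' u \<partial>sample {..<M} h' \<partial>sample {..<M} h \<partial>H \<partial>H)"
    unfolding \<Phi>_def by (intro nn_integral_cong nn_integral_flux) measurable
  also have "\<dots> = (\<integral>\<^sup>+h. \<integral>\<^sup>+h'. \<integral>\<^sup>+v. \<integral>\<^sup>+u. \<Phi> h v h' u \<partial>sample {..<M} h' \<partial>sample {..<M} h \<partial>H \<partial>H)"
    by (rule HH.Fubini') measurable
  also have "\<dots> = (\<integral>\<^sup>+h. \<integral>\<^sup>+h'. \<integral>\<^sup>+u. \<integral>\<^sup>+v. \<Phi> h v h' u \<partial>sample {..<M} h \<partial>sample {..<M} h' \<partial>H \<partial>H)"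
  proof (intro nn_integral_cong)
    fix h h' assume [measurable]: "h \<in> space H" "h' \<in> space H"
    interpret pair_sigma_finite "sample {..<M} h'" "sample {..<M} h"
      by (intro pair_sigma_finite.intro prob_space_imp_sigma_finite prob_space_sample) fact+
    show "(\<integral>\<^sup>+v. \<integral>\<^sup>+u. \<Phi> h v h' u \<partial>sample {..<M} h' \<partial>sample {..<M} h) =
        (\<integral>\<^sup>+u. \<integral>\<^sup>+v. \<Phi> h v h' u \<partial>sample {..<M} h \<partial>sample {..<M} h')"
      by (rule Fubini') measurable
  qed
  also have "\<dots> = (\<integral>\<^sup>+h'. \<integral>\<^sup>+h. \<integral>\<^sup>+t. ennreal (f h t * g h') * flux h t h' (\<lambda>s. G h' s h t) \<partial>T \<partial>H \<partial>H)"
  proof (intro nn_integral_cong)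
    fix h h' assume [measurable]: "h \<in> space H" "h' \<in> space H"
    have "(\<integral>\<^sup>+t. ennreal (f h t * g h') * flux h t h' (\<lambda>s. G h' s h t) \<partial>T) =
      (\<integral>\<^sup>+v. \<integral>\<^sup>+u. of_nat M * (ennreal (w h (v 0) * w h' (u 0) * swap_rate h v h' u) * G h' (u 0) h (v 0))
      \<partial>sample {..<M} h' \<partial>sample {..<M} h)"
      by (intro nn_integral_flux) measurable
    then show "(\<integral>\<^sup>+v. \<integral>\<^sup>+u. \<Phi> h' u h v \<partial>sample {..<M} h' \<partial>sample {..<M} h) =
      (\<integral>\<^sup>+t. ennreal (f h t * g h') * flux h t h' (\<lambda>s. G h' s h t) \<partial>T)"
      by (simp add: \<Phi>_def swap_rate_commute[of h'] mult.commute[of "w h' _"])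
  qed
  finally show ?thesis .
qed

end

section \<open>The swap kernel on an abstract state space\<close>

text \<open>
  A state is described by the hat part, the tilde part, the next level and the remaining
  coordinates \<open>r\<close>; \<open>build\<close> assembles it from these. The last assumption says that in these
  coordinates the target \<open>\<mu>\<close> has the density \<open>f h t * g h'\<close>, where \<open>R\<close> already contains the
  densities of the remaining coordinates.
\<close>

locale try_swap = try_pool H T f q g M
  for H :: "'h measure" and T :: "'t measure" and f q :: "'h \<Rightarrow> 't \<Rightarrow> real" and g :: "'h \<Rightarrow> real" and M :: nat +
  fixes S :: "'s measure" and R :: "'r measure" and \<mu> :: "'s measure"
    and hat :: "'s \<Rightarrow> 'h" and til :: "'s \<Rightarrow> 't" and nxt :: "'s \<Rightarrow> 'h"
    and move :: "'s \<Rightarrow> 't \<Rightarrow> 's" and build :: "'r \<Rightarrow> 'h \<Rightarrow> 't \<Rightarrow> 'h \<Rightarrow> 's"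
  assumes hat[measurable]: "hat \<in> S \<rightarrow>\<^sub>M H"
    and til[measurable]: "til \<in> S \<rightarrow>\<^sub>M T"
    and nxt[measurable]: "nxt \<in> S \<rightarrow>\<^sub>M H"
    and move: "case_prod move \<in> S \<Otimes>\<^sub>M T \<rightarrow>\<^sub>M S"
    and build: "r \<in> space R \<Longrightarrow> (\<lambda>(h, t, h'). build r h t h') \<in> H \<Otimes>\<^sub>M T \<Otimes>\<^sub>M H \<rightarrow>\<^sub>M S"
    and hat_build: "r \<in> space R \<Longrightarrow> h \<in> space H \<Longrightarrow> t \<in> space T \<Longrightarrow> h' \<in> space H \<Longrightarrow>
      hat (build r h t h') = h"
    and til_build: "r \<in> space R \<Longrightarrow> h \<in> space H \<Longrightarrow> t \<in> space T \<Longrightarrow> h' \<in> space H \<Longrightarrow>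
      til (build r h t h') = t"
    and nxt_build: "r \<in> space R \<Longrightarrow> h \<in> space H \<Longrightarrow> t \<in> space T \<Longrightarrow> h' \<in> space H \<Longrightarrow>
      nxt (build r h t h') = h'"
    and move_build: "r \<in> space R \<Longrightarrow> h \<in> space H \<Longrightarrow> t \<in> space T \<Longrightarrow> h' \<in> space H \<Longrightarrow>
      s \<in> space T \<Longrightarrow> move (build r h t h') s = build r h' s h"
    and sets_\<mu>[measurable_cong]: "sets \<mu> = sets S"
    and nn_integral_\<mu>: "F \<in> borel_measurable S \<Longrightarrow> (\<integral>\<^sup>+x. F x \<partial>\<mu>) =
      (\<integral>\<^sup>+r. \<integral>\<^sup>+h'. \<integral>\<^sup>+h. \<integral>\<^sup>+t. ennreal (f h t * g h') * F (build r h t h') \<partial>T \<partial>H \<partial>H \<partial>R)"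
begin

definition step :: "'s \<Rightarrow> (nat \<Rightarrow> 't) \<Rightarrow> (nat \<Rightarrow> 't) \<Rightarrow> 's measure" where
  "step x v u =
    (if ok (hat x) (nxt x) v u then do {
       j \<leftarrow> point_measure {..<M} (\<lambda>j. ennreal (w (nxt x) (u j) / W (nxt x) u));
       accept \<leftarrow> measure_pmf (bernoulli_pmf (acc (hat x) (nxt x) v u));
       return S (if accept then move x (u j) else x)
     }
     else return S x)"

definition kernel :: "'s \<Rightarrow> 's measure" where
  "kernel x = do {
     v' \<leftarrow> sample {1..<M} (hat x);
     u \<leftarrow> sample {..<M} (nxt x);
     step x (v'(0 := til x)) u
   }"

text \<open>The probability of rejection, given both pools.\<close>

definition stay :: "'s \<Rightarrow> (nat \<Rightarrow> 't) \<Rightarrow> (nat \<Rightarrow> 't) \<Rightarrow> ennreal" where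
  "stay x v u = (if ok (hat x) (nxt x) v u then ennreal (1 - acc (hat x) (nxt x) v u) else 1)"

definition stay_prob :: "'s \<Rightarrow> ennreal" where
  "stay_prob x = (\<integral>\<^sup>+v'. \<integral>\<^sup>+u. stay x (v'(0 := til x)) u \<partial>sample {..<M} (nxt x) \<partial>sample {1..<M} (hat x))"

lemma move_measurable[measurable (raw)]:
  assumes "a \<in> N \<rightarrow>\<^sub>M S" "b \<in> N \<rightarrow>\<^sub>M T"
  shows "(\<lambda>x. move (a x) (b x)) \<in> N \<rightarrow>\<^sub>M S"
  using measurable_compose[OF measurable_Pair[OF assms] move] by simp

lemma stay_measurable[measurable (raw)]:
  assumes [measurable]: "a \<in> N \<rightarrow>\<^sub>M S" "b \<in> N \<rightarrow>\<^sub>M tries {..<M}" "c \<in> N \<rightarrow>\<^sub>M tries {..<M}"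
  shows "(\<lambda>x. stay (a x) (b x) (c x)) \<in> borel_measurable N"
  unfolding stay_def by measurable

lemma sum_selection_prob:
  assumes x: "x \<in> space S" and u: "u \<in> space (tries {..<M})" and W: "W (nxt x) u \<noteq> 0"
  shows "(\<Sum>j<M. ennreal (w (nxt x) (u j) / W (nxt x) u)) = 1"
proof -
  have h': "nxt x \<in> space H"
    by (rule measurable_space[OF nxt x])
  have "(\<Sum>j<M. ennreal (w (nxt x) (u j) / W (nxt x) u)) = ennreal (\<Sum>j<M. w (nxt x) (u j) / W (nxt x) u)"
    by (intro sum_ennreal divide_nonneg_nonneg w_nonneg W_nonneg h' u tries_component[OF u]) simp
  also have "(\<Sum>j<M. w (nxt x) (u j) / W (nxt x) u) = 1"
    using W by (simp add: W_def flip: sum_divide_distrib)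
  finally show ?thesis by simp
qed

lemma sets_step[simp]: "sets (step x v u) = sets S"
proof (cases "ok (hat x) (nxt x) v u")
  case True
  then show ?thesis
    unfolding step_def using M_pos
    by (auto simp: space_point_measure intro!: sets_bind)
qed (simp add: step_def)

lemma nn_integral_step:
  assumes x: "x \<in> space S" and v: "v \<in> space (tries {..<M})" and u: "u \<in> space (tries {..<M})"
    and B[measurable]: "B \<in> borel_measurable S"
  shows "(\<integral>\<^sup>+y. B y \<partial>step x v u) =
    (if ok (hat x) (nxt x) v u
     then \<Sum>j<M. ennreal (w (nxt x) (u j) / W (nxt x) u * acc (hat x) (nxt x) v u) * B (move x (u j)) else 0)
    + stay x v u * B x"
proof (cases "ok (hat x) (nxt x) v u")
  case True
  define \<alpha> where "\<alpha> = acc (hat x) (nxt x) v u"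
  define \<omega> where "\<omega> j = w (nxt x) (u j) / W (nxt x) u" for j
  have space: "hat x \<in> space H" "nxt x \<in> space H"
    by (rule measurable_space[OF hat x] measurable_space[OF nxt x])+
  have \<alpha>: "0 \<le> \<alpha>" "\<alpha> \<le> 1"
    unfolding \<alpha>_def by (auto intro: acc_nonneg space v u acc_le_1)
  have uj: "u j \<in> space T" if "j < M" for j
    using tries_component[OF u] that by simp
  have moved: "move x (u j) \<in> space S" if "j < M" for j
    using measurable_space[OF move, of "(x, u j)"] x uj[OF that] by (simp add: space_pair_measure)
  have \<omega>: "0 \<le> \<omega> j" if "j < M" for j
    unfolding \<omega>_def by (intro divide_nonneg_nonneg w_nonneg W_nonneg space u uj that)
  have sum_\<omega>: "(\<Sum>j<M. ennreal (\<omega> j)) = 1"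
    unfolding \<omega>_def using True by (intro sum_selection_prob x u) (simp add: ok_def)
  define flip where "flip j = measure_pmf (bernoulli_pmf \<alpha>) \<bind> (\<lambda>b. return S (if b then move x (u j) else x))" for j
  have ret: "(\<lambda>b. return S (if b then move x (u j) else x)) \<in> measure_pmf (bernoulli_pmf \<alpha>) \<rightarrow>\<^sub>M subprob_algebra S"
    if "j < M" for j
    using x moved[OF that] by (auto simp: space_subprob_algebra intro!: subprob_space_return)
  have flip_space: "flip j \<in> space (subprob_algebra S)" if "j < M" for j
    unfolding flip_def using ret[OF that] subprob_space_bind[OF _ ret[OF that]]
    by (auto simp: space_subprob_algebra prob_space_imp_subprob_space measure_pmf.prob_space_axioms
        intro!: sets_bind)
  have flip: "(\<integral>\<^sup>+y. B y \<partial>flip j) = ennreal \<alpha> * B (move x (u j)) + ennreal (1 - \<alpha>) * B x" if "j < M" for j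
    unfolding flip_def
    using \<alpha> x moved[OF that] by (simp add: nn_integral_bind[OF B ret[OF that]] nn_integral_return mult.commute)
  have "step x v u = point_measure {..<M} (\<lambda>j. ennreal (\<omega> j)) \<bind> flip"
    using True by (simp add: step_def flip_def[abs_def] \<alpha>_def \<omega>_def)
  then have "(\<integral>\<^sup>+y. B y \<partial>step x v u) = (\<integral>\<^sup>+j. \<integral>\<^sup>+y. B y \<partial>flip j \<partial>point_measure {..<M} (\<lambda>j. ennreal (\<omega> j)))"
    using flip_space by (simp only:, intro nn_integral_bind[OF B]) auto
  also have "\<dots> = (\<Sum>j<M. ennreal (\<omega> j) * (\<integral>\<^sup>+y. B y \<partial>flip j))"
    by (rule nn_integral_point_measure_finite) auto
  also have "\<dots> = (\<Sum>j<M. ennreal (\<omega> j * \<alpha>) * B (move x (u j)) + ennreal (\<omega> j) * (ennreal (1 - \<alpha>) * B x))"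
    using \<omega> \<alpha> by (intro sum.cong) (auto simp: flip distrib_left ennreal_mult mult.assoc)
  also have "\<dots> = (\<Sum>j<M. ennreal (\<omega> j * \<alpha>) * B (move x (u j))) + ennreal (1 - \<alpha>) * B x"
    by (simp add: sum.distrib sum_\<omega> flip: sum_distrib_right)
  finally show ?thesis
    using True by (simp add: \<alpha>_def \<omega>_def stay_def)
next
  case False
  then show ?thesis
    using x by (simp add: step_def stay_def nn_integral_return)
qed

lemma emeasure_step_space:
  assumes x: "x \<in> space S" and v: "v \<in> space (tries {..<M})" and u: "u \<in> space (tries {..<M})"
  shows "emeasure (step x v u) (space S) = 1"
proof -
  have "hat x \<in> space H" "nxt x \<in> space H"
    by (rule measurable_space[OF hat x] measurable_space[OF nxt x])+
  then have acc: "0 \<le> acc (hat x) (nxt x) v u" "acc (hat x) (nxt x) v u \<le> 1"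
    by (auto intro: acc_nonneg v u acc_le_1)
  have split: "ennreal (w (nxt x) (u j) / W (nxt x) u * acc (hat x) (nxt x) v u) =
      ennreal (w (nxt x) (u j) / W (nxt x) u) * ennreal (acc (hat x) (nxt x) v u)" for j
    by (rule ennreal_mult''[OF acc(1)])
  have "emeasure (step x v u) (space S) = (\<integral>\<^sup>+y. 1 \<partial>step x v u)"
    using sets_eq_imp_space_eq[OF sets_step[of x v u]] by simp
  also have "\<dots> = (if ok (hat x) (nxt x) v u then ennreal (acc (hat x) (nxt x) v u) else 0) + stay x v u"
    unfolding nn_integral_step[OF x v u borel_measurable_const] split mult_1_right
      sum_distrib_right[symmetric]
    using sum_selection_prob[OF x u] by (cases "ok (hat x) (nxt x) v u") (auto simp: ok_def)
  also have "\<dots> = 1"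
    using acc by (auto simp: stay_def simp flip: ennreal_plus)
  finally show ?thesis .
qed

text \<open>
  The selection probabilities and the coin depend on the state, but only finitely many outcomes are
  possible. Measurability can therefore be read off the explicit formula of \<open>nn_integral_step\<close>.
\<close>

lemma step_kernel:
  "(\<lambda>(x, v, u). step x v u) \<in> S \<Otimes>\<^sub>M tries {..<M} \<Otimes>\<^sub>M tries {..<M} \<rightarrow>\<^sub>M subprob_algebra S"
proof (rule measurable_subprob_algebra)
  fix z assume z: "z \<in> space (S \<Otimes>\<^sub>M tries {..<M} \<Otimes>\<^sub>M tries {..<M})"
  show "sets (case z of (x, v, u) \<Rightarrow> step x v u) = sets S"
    by (simp split: prod.split)
  have "space (step x v u) = space S" for x v u
    by (rule sets_eq_imp_space_eq) simp
  then have "prob_space (case z of (x, v, u) \<Rightarrow> step x v u)"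
    using z by (intro prob_spaceI) (auto simp: space_pair_measure emeasure_step_space)
  then show "subprob_space (case z of (x, v, u) \<Rightarrow> step x v u)"
    by (rule prob_space_imp_subprob_space)
next
  fix A assume A[measurable]: "A \<in> sets S"
  have [measurable]: "(\<lambda>u. u j) \<in> tries {..<M} \<rightarrow>\<^sub>M T" if "j \<in> {..<M}" for j
    using that by (intro measurable_component_singleton) simp
  have "(\<lambda>(x, v, u). (if ok (hat x) (nxt x) v u
     then \<Sum>j<M. ennreal (w (nxt x) (u j) / W (nxt x) u * acc (hat x) (nxt x) v u) * indicator A (move x (u j)) else 0)
    + stay x v u * indicator A x) \<in> borel_measurable (S \<Otimes>\<^sub>M tries {..<M} \<Otimes>\<^sub>M tries {..<M})"
    by measurable
  then show "(\<lambda>z. emeasure (case z of (x, v, u) \<Rightarrow> step x v u) A)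
      \<in> borel_measurable (S \<Otimes>\<^sub>M tries {..<M} \<Otimes>\<^sub>M tries {..<M})"
    by (rule measurable_cong[THEN iffD1, rotated])
       (auto simp: space_pair_measure nn_integral_step simp flip: nn_integral_indicator)
qed

lemma step_measurable[measurable (raw)]:
  assumes [measurable]: "a \<in> N \<rightarrow>\<^sub>M S" "b \<in> N \<rightarrow>\<^sub>M tries {..<M}" "c \<in> N \<rightarrow>\<^sub>M tries {..<M}"
  shows "(\<lambda>x. step (a x) (b x) (c x)) \<in> N \<rightarrow>\<^sub>M subprob_algebra S"
proof -
  have "(\<lambda>x. (a x, b x, c x)) \<in> N \<rightarrow>\<^sub>M S \<Otimes>\<^sub>M tries {..<M} \<Otimes>\<^sub>M tries {..<M}"
    by measurable
  from measurable_compose[OF this step_kernel] show ?thesis by simp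
qed

lemma sample_measurable[measurable (raw)]:
  assumes "finite I" "a \<in> N \<rightarrow>\<^sub>M H"
  shows "(\<lambda>x. sample I (a x)) \<in> N \<rightarrow>\<^sub>M subprob_algebra (tries I)"
  by (rule measurable_compose[OF assms(2) measurable_prob_algebraD[OF sample_kernel[OF assms(1)]]])

lemma kernel_measurable: "kernel \<in> S \<rightarrow>\<^sub>M subprob_algebra S"
  unfolding kernel_def[abs_def] by measurable

lemma nn_integral_kernel:
  assumes x[measurable]: "x \<in> space S" and B[measurable]: "B \<in> borel_measurable S"
  shows "(\<integral>\<^sup>+y. B y \<partial>kernel x) =
    flux (hat x) (til x) (nxt x) (\<lambda>s. B (move x s)) + stay_prob x * B x"
proof -
  have [measurable]: "(\<lambda>u. u j) \<in> tries {..<M} \<rightarrow>\<^sub>M T" if "j \<in> {..<M}" for j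
    using that by (intro measurable_component_singleton) simp
  have sp[measurable]: "hat x \<in> space H" "til x \<in> space T" "nxt x \<in> space H"
    by (rule measurable_space[OF hat x] measurable_space[OF nxt x] measurable_space[OF til x])+
  define jump where "jump v u = (if ok (hat x) (nxt x) v u
     then \<Sum>j<M. ennreal (w (nxt x) (u j) / W (nxt x) u * acc (hat x) (nxt x) v u) * B (move x (u j)) else 0)" for v u
  have [measurable]: "(\<lambda>z. jump (fst z) (snd z)) \<in> borel_measurable (tries {..<M} \<Otimes>\<^sub>M tries {..<M})"
    unfolding jump_def by measurable
  have jump[measurable (raw)]: "(\<lambda>z. jump (b z) (c z)) \<in> borel_measurable N"
    if [measurable]: "b \<in> N \<rightarrow>\<^sub>M tries {..<M}" "c \<in> N \<rightarrow>\<^sub>M tries {..<M}" for b c and N :: "'x measure"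
    using measurable_compose[OF measurable_Pair[OF that]
        \<open>(\<lambda>z. jump (fst z) (snd z)) \<in> borel_measurable (tries {..<M} \<Otimes>\<^sub>M tries {..<M})\<close>] by simp
  have upd[measurable]: "v'(0 := til x) \<in> space (tries {..<M})" if "v' \<in> space (tries {1..<M})" for v'
    using that sp M_pos by (auto simp: space_PiM PiE_iff extensional_def)
  have "(\<integral>\<^sup>+y. B y \<partial>kernel x) = (\<integral>\<^sup>+v'. \<integral>\<^sup>+y. B y \<partial>(sample {..<M} (nxt x) \<bind> step x (v'(0 := til x)))
      \<partial>sample {1..<M} (hat x))"
    unfolding kernel_def by (rule nn_integral_bind[OF B]) measurable
  also have "\<dots> = (\<integral>\<^sup>+v'. \<integral>\<^sup>+u. \<integral>\<^sup>+y. B y \<partial>step x (v'(0 := til x)) u \<partial>sample {..<M} (nxt x)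
      \<partial>sample {1..<M} (hat x))"
    by (intro nn_integral_cong nn_integral_bind[OF B]) measurable
  also have "\<dots> = (\<integral>\<^sup>+v'. \<integral>\<^sup>+u. jump (v'(0 := til x)) u + stay x (v'(0 := til x)) u * B x
      \<partial>sample {..<M} (nxt x) \<partial>sample {1..<M} (hat x))"
    unfolding jump_def by (intro nn_integral_cong nn_integral_step x B) (auto intro: upd)
  also have "\<dots> = (\<integral>\<^sup>+v'. (\<integral>\<^sup>+u. jump (v'(0 := til x)) u \<partial>sample {..<M} (nxt x)) +
      (\<integral>\<^sup>+u. stay x (v'(0 := til x)) u \<partial>sample {..<M} (nxt x)) * B x \<partial>sample {1..<M} (hat x))"
    by (intro nn_integral_cong) (simp add: nn_integral_add nn_integral_multc)
  also have "\<dots> = (\<integral>\<^sup>+v'. \<integral>\<^sup>+u. jump (v'(0 := til x)) u \<partial>sample {..<M} (nxt x) \<partial>sample {1..<M} (hat x))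
      + stay_prob x * B x"
    unfolding stay_prob_def
    by (subst nn_integral_add) (measurable, subst nn_integral_multc, measurable)
  finally show ?thesis
    by (simp add: jump_def flux_def)
qed

text \<open>
  The second summand lives on the diagonal, so it does not change when the arguments of \<open>B\<close> are
  exchanged.
\<close>

lemma nn_integral_\<mu>_kernel:
  assumes B[measurable]: "case_prod B \<in> borel_measurable (S \<Otimes>\<^sub>M S)"
  shows "(\<integral>\<^sup>+x. \<integral>\<^sup>+y. B x y \<partial>kernel x \<partial>\<mu>) =
    (\<integral>\<^sup>+r. \<integral>\<^sup>+h'. \<integral>\<^sup>+h. \<integral>\<^sup>+t. ennreal (f h t * g h') *
       flux h t h' (\<lambda>s. B (build r h t h') (build r h' s h)) \<partial>T \<partial>H \<partial>H \<partial>R)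
    + (\<integral>\<^sup>+x. stay_prob x * B x x \<partial>\<mu>)"
proof -
  have [measurable]: "(\<lambda>u. u j) \<in> tries {..<M} \<rightarrow>\<^sub>M T" if "j \<in> {..<M}" for j
    using that by (intro measurable_component_singleton) simp
  let ?flux = "\<lambda>x. flux (hat x) (til x) (nxt x) (\<lambda>s. B x (move x s))"
  have flux[measurable]: "?flux \<in> borel_measurable S"
    unfolding flux_def by measurable
  have [measurable]: "stay_prob \<in> borel_measurable S"
    unfolding stay_prob_def[abs_def] by measurable
  have "(\<integral>\<^sup>+x. \<integral>\<^sup>+y. B x y \<partial>kernel x \<partial>\<mu>) = (\<integral>\<^sup>+x. ?flux x + stay_prob x * B x x \<partial>\<mu>)"
  proof (rule nn_integral_cong)
    fix x assume "x \<in> space \<mu>"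
    then have x: "x \<in> space S"
      using sets_eq_imp_space_eq[OF sets_\<mu>] by simp
    have "B x \<in> borel_measurable S"
      using measurable_Pair2[OF B x] by simp
    then show "(\<integral>\<^sup>+y. B x y \<partial>kernel x) = ?flux x + stay_prob x * B x x"
      by (rule nn_integral_kernel[OF x])
  qed
  also have "\<dots> = (\<integral>\<^sup>+x. ?flux x \<partial>\<mu>) + (\<integral>\<^sup>+x. stay_prob x * B x x \<partial>\<mu>)"
    by (rule nn_integral_add) measurable
  also have "(\<integral>\<^sup>+x. ?flux x \<partial>\<mu>) =
      (\<integral>\<^sup>+r. \<integral>\<^sup>+h'. \<integral>\<^sup>+h. \<integral>\<^sup>+t. ennreal (f h t * g h') * ?flux (build r h t h') \<partial>T \<partial>H \<partial>H \<partial>R)"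
    by (rule nn_integral_\<mu>[OF flux])
  also have "\<dots> = (\<integral>\<^sup>+r. \<integral>\<^sup>+h'. \<integral>\<^sup>+h. \<integral>\<^sup>+t. ennreal (f h t * g h') *
       flux h t h' (\<lambda>s. B (build r h t h') (build r h' s h)) \<partial>T \<partial>H \<partial>H \<partial>R)"
    by (intro nn_integral_cong arg_cong2[where f="(*)"] refl)
       (auto simp: hat_build til_build nxt_build move_build flux_def tries_component
        intro!: nn_integral_cong sum.cong)
  finally show ?thesis .
qed

theorem kernel_reversible:
  assumes B: "case_prod B \<in> borel_measurable (S \<Otimes>\<^sub>M S)"
  shows "(\<integral>\<^sup>+x. \<integral>\<^sup>+y. B x y \<partial>kernel x \<partial>\<mu>) = (\<integral>\<^sup>+x. \<integral>\<^sup>+y. B y x \<partial>kernel x \<partial>\<mu>)"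
proof -
  have B': "(\<lambda>(x, y). B y x) \<in> borel_measurable (S \<Otimes>\<^sub>M S)"
    using measurable_compose[OF measurable_pair_swap' B] by (simp add: split_beta')
  have "(\<integral>\<^sup>+h'. \<integral>\<^sup>+h. \<integral>\<^sup>+t. ennreal (f h t * g h') *
       flux h t h' (\<lambda>s. B (build r h t h') (build r h' s h)) \<partial>T \<partial>H \<partial>H) =
      (\<integral>\<^sup>+h'. \<integral>\<^sup>+h. \<integral>\<^sup>+t. ennreal (f h t * g h') *
       flux h t h' (\<lambda>s. B (build r h' s h) (build r h t h')) \<partial>T \<partial>H \<partial>H)" if r: "r \<in> space R" for r
  proof (rule flux_balance)
    have b: "(\<lambda>z. build r (a z) (b z) (c z)) \<in> N \<rightarrow>\<^sub>M S"
      if [measurable]: "a \<in> N \<rightarrow>\<^sub>M H" "b \<in> N \<rightarrow>\<^sub>M T" "c \<in> N \<rightarrow>\<^sub>M H" for a b c and N :: "'x measure"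
    proof -
      have "(\<lambda>z. (a z, b z, c z)) \<in> N \<rightarrow>\<^sub>M H \<Otimes>\<^sub>M T \<Otimes>\<^sub>M H"
        by measurable
      from measurable_compose[OF this build[OF r]] show ?thesis by simp
    qed
    have "(\<lambda>(h, t, h', s). (build r h t h', build r h' s h)) \<in> H \<Otimes>\<^sub>M T \<Otimes>\<^sub>M H \<Otimes>\<^sub>M T \<rightarrow>\<^sub>M S \<Otimes>\<^sub>M S"
      unfolding split_beta' by (intro measurable_Pair b) measurable
    from measurable_compose[OF this B]
    show "(\<lambda>(h, t, h', s). B (build r h t h') (build r h' s h)) \<in> borel_measurable (H \<Otimes>\<^sub>M T \<Otimes>\<^sub>M H \<Otimes>\<^sub>M T)"
      by (simp add: split_beta')
  qed
  from arg_cong2[where f="(+)", OF nn_integral_cong[OF this] refl] show ?thesis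
    unfolding nn_integral_\<mu>_kernel[OF B] nn_integral_\<mu>_kernel[OF B'] .
qed

text \<open>
  Detailed balance is reversibility tested on indicator functions. An empty state space is treated
  separately because \<open>bind\<close> then ignores the kernel.
\<close>

theorem detailed_balance_kernel: "detailed_balance \<mu> kernel"
proof (cases "space S = {}")
  case True
  then have "space \<mu> = {}"
    using sets_eq_imp_space_eq[OF sets_\<mu>] by simp
  then show ?thesis
    unfolding detailed_balance_def by (simp add: bind_empty)
next
  case False
  have ne: "space \<mu> \<noteq> {}"
    using False sets_eq_imp_space_eq[OF sets_\<mu>] by simp
  have K[measurable]: "kernel \<in> \<mu> \<rightarrow>\<^sub>M subprob_algebra \<mu>"
    using kernel_measurable
    by (simp add: subprob_algebra_cong[OF sets_\<mu>] measurable_cong_sets[OF sets_\<mu> refl])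
  let ?P = "\<mu> \<Otimes>\<^sub>M \<mu>"
  have pair: "(\<lambda>x. kernel x \<bind> (\<lambda>y. return ?P (x, y))) \<in> \<mu> \<rightarrow>\<^sub>M subprob_algebra ?P"
    by measurable
  have swap: "(\<lambda>y. kernel y \<bind> (\<lambda>x. return ?P (x, y))) \<in> \<mu> \<rightarrow>\<^sub>M subprob_algebra ?P"
    by measurable
  have inner: "emeasure (kernel x \<bind> (\<lambda>y. return ?P (\<phi> y))) A = (\<integral>\<^sup>+y. indicator A (\<phi> y) \<partial>kernel x)"
    if x: "x \<in> space \<mu>" and A: "A \<in> sets ?P" and \<phi>[measurable]: "\<phi> \<in> \<mu> \<rightarrow>\<^sub>M ?P" for x A \<phi>
  proof -
    have sets[measurable_cong]: "sets (kernel x) = sets \<mu>"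
      by (rule sets_kernel[OF K x])
    have "space (kernel x) \<noteq> {}"
      using ne sets_eq_imp_space_eq[OF sets] by simp
    then have "emeasure (kernel x \<bind> (\<lambda>y. return ?P (\<phi> y))) A =
        (\<integral>\<^sup>+y. emeasure (return ?P (\<phi> y)) A \<partial>kernel x)"
      by (rule emeasure_bind[OF _ _ A]) measurable
    also have "\<dots> = (\<integral>\<^sup>+y. indicator A (\<phi> y) \<partial>kernel x)"
      using A by simp
    finally show ?thesis .
  qed
  show ?thesis
    unfolding detailed_balance_def
  proof (rule measure_eqI)
    show "sets (\<mu> \<bind> (\<lambda>x. kernel x \<bind> (\<lambda>y. return ?P (x, y)))) =
        sets (\<mu> \<bind> (\<lambda>y. kernel y \<bind> (\<lambda>x. return ?P (x, y))))"
      by (simp add: sets_bind_measurable[OF pair ne] sets_bind_measurable[OF swap ne])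
    fix A assume "A \<in> sets (\<mu> \<bind> (\<lambda>x. kernel x \<bind> (\<lambda>y. return ?P (x, y))))"
    then have A: "A \<in> sets ?P"
      by (simp add: sets_bind_measurable[OF pair ne])
    then have "A \<in> sets (S \<Otimes>\<^sub>M S)"
      using sets_pair_measure_cong[OF sets_\<mu> sets_\<mu>] by simp
    then have "(\<lambda>(x, y). indicator A (x, y) :: ennreal) \<in> borel_measurable (S \<Otimes>\<^sub>M S)"
      by simp
    then have "(\<integral>\<^sup>+x. \<integral>\<^sup>+y. indicator A (x, y) \<partial>kernel x \<partial>\<mu>) =
        (\<integral>\<^sup>+y. \<integral>\<^sup>+x. indicator A (x, y) \<partial>kernel y \<partial>\<mu>)"
      by (rule kernel_reversible)
    also have "(\<integral>\<^sup>+x. \<integral>\<^sup>+y. indicator A (x, y) \<partial>kernel x \<partial>\<mu>) =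
        emeasure (\<mu> \<bind> (\<lambda>x. kernel x \<bind> (\<lambda>y. return ?P (x, y)))) A"
      unfolding emeasure_bind[OF ne pair A]
      by (intro nn_integral_cong inner[symmetric] A) auto
    also have "(\<integral>\<^sup>+y. \<integral>\<^sup>+x. indicator A (x, y) \<partial>kernel y \<partial>\<mu>) =
        emeasure (\<mu> \<bind> (\<lambda>y. kernel y \<bind> (\<lambda>x. return ?P (x, y)))) A"
      unfolding emeasure_bind[OF ne swap A]
      by (intro nn_integral_cong inner[symmetric] A) auto
    finally show "emeasure (\<mu> \<bind> (\<lambda>x. kernel x \<bind> (\<lambda>y. return ?P (x, y)))) A =
        emeasure (\<mu> \<bind> (\<lambda>y. kernel y \<bind> (\<lambda>x. return ?P (x, y)))) A" .
  qed
qed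

end

section \<open>Detailed balance of the multiple-try swap\<close>

text \<open>
  The abstract setting applies with \<open>r\<close> ranging over the coordinates outside \<open>i\<close> and \<open>i + 1\<close>,
  weighted by their densities. What has to be checked is that \<open>merge\<close> and function update give
  measurable coordinates on the state space in which the target density factorizes.
\<close>

theorem lemma2:
  fixes L M i :: nat
    and d :: "nat \<Rightarrow> nat"
    and \<pi> :: "nat \<Rightarrow> (nat \<Rightarrow> real) \<Rightarrow> real"
    and p :: "nat \<Rightarrow> (nat \<Rightarrow> real) \<Rightarrow> (nat \<Rightarrow> real) \<Rightarrow> real"
  assumes "L \<ge> 1"
    and "\<forall>j<L. d (Suc j) < d j"
    and "d L \<ge> 1"
    and "\<forall>j\<le>L. prob_density (euclid {..<d j}) (\<pi> j)"
    and "\<forall>j<L. cond_prob_density (euclid (hat_ix d j)) (euclid (tilde_ix d j)) (p j)"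
    and "M \<ge> 1"
    and "i < L"
  shows "detailed_balance (target_measure L d \<pi>) (swap_kernel L d \<pi> p M i)"
proof -
  define H where "H = euclid (hat_ix d i)"
  define T where "T = euclid (tilde_ix d i)"
  define S where "S = state_space L d"
  \<comment> \<open>The levels that the move leaves alone.\<close>
  define J where "J = {..L} - {i, Suc i}"
  define \<rho> where "\<rho> r = (\<Prod>j\<in>J. \<pi> j (r j))" for r :: "nat \<Rightarrow> nat \<Rightarrow> real"
  define P where "P = (\<Pi>\<^sub>M j\<in>J. euclid {..<d j})"
  define R where "R = density P (\<lambda>r. ennreal (\<rho> r))"
  define f where "f h t = \<pi> i (merge (hat_ix d i) (tilde_ix d i) (h, t))" for h t
  define build where "build r h t h' = r(Suc i := h', i := merge (hat_ix d i) (tilde_ix d i) (h, t))"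
    for r :: "nat \<Rightarrow> nat \<Rightarrow> real" and h t h'
  have Ui: "{..<d i} = hat_ix d i \<union> tilde_ix d i" "hat_ix d i \<inter> tilde_ix d i = {}"
    using assms(2) \<open>i < L\<close> by force+
  have J: "finite J" "i \<notin> insert (Suc i) J" "Suc i \<notin> J" "{..L} = insert i (insert (Suc i) J)"
    using \<open>i < L\<close> by (auto simp: J_def)
  interpret lb: product_sigma_finite "\<lambda>_::nat. lborel :: real measure"
    by (simp add: product_sigma_finite_def sigma_finite_lborel)
  interpret H: sigma_finite_measure H
    unfolding H_def by (rule lb.sigma_finite) simp
  interpret T: sigma_finite_measure T
    unfolding T_def by (rule lb.sigma_finite) simp
  interpret st: product_sigma_finite "\<lambda>j. euclid {..<d j}"
    by (simp add: product_sigma_finite_def lb.sigma_finite)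
  have \<pi>_meas: "\<pi> j \<in> borel_measurable (euclid {..<d j})" if "j \<le> L" for j
    using assms(4) that by (auto simp: prob_density_def)
  have \<pi>_nonneg: "0 \<le> \<pi> j a" if "j \<le> L" "a \<in> space (euclid {..<d j})" for j a
    using assms(4) that by (auto simp: prob_density_def)
  have \<pi>_comp: "(\<lambda>x. \<pi> j (x j)) \<in> borel_measurable (\<Pi>\<^sub>M j\<in>A. euclid {..<d j})" if "j \<in> A" "j \<le> L" for j A
    using measurable_component_singleton[OF that(1), of "\<lambda>j. euclid {..<d j}"] \<pi>_meas[OF that(2)]
    by (rule measurable_compose)
  have merge_meas[measurable]: "merge (hat_ix d i) (tilde_ix d i) \<in> H \<Otimes>\<^sub>M T \<rightarrow>\<^sub>M euclid {..<d i}"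
    unfolding H_def T_def Ui(1) by (rule measurable_merge)
  have merge_space: "merge (hat_ix d i) (tilde_ix d i) (h, t) \<in> space (euclid {..<d i})"
    if "h \<in> space H" "t \<in> space T" for h t
    using measurable_space[OF merge_meas, of "(h, t)"] that by (simp add: space_pair_measure)
  have g_meas[measurable]: "\<pi> (Suc i) \<in> borel_measurable H"
    unfolding H_def using \<open>i < L\<close> by (intro \<pi>_meas) simp
  have f_meas[measurable]: "case_prod f \<in> borel_measurable (H \<Otimes>\<^sub>M T)"
    using measurable_compose[OF merge_meas \<pi>_meas[of i]] \<open>i < L\<close> by (simp add: f_def split_beta')
  have q: "cond_prob_density H T (p i)"
    unfolding H_def T_def using assms(5) \<open>i < L\<close> by simp
  have \<rho>_meas[measurable]: "\<rho> \<in> borel_measurable P"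
    unfolding \<rho>_def[abs_def] P_def
    by (intro borel_measurable_prod \<pi>_comp) (auto simp: J_def)
  note upd_meas = measurable_fun_upd[where M = "\<lambda>j. euclid {..<d j}"]
  have build_meas[measurable]: "(\<lambda>(r, h, t, h'). build r h t h') \<in> P \<Otimes>\<^sub>M H \<Otimes>\<^sub>M T \<Otimes>\<^sub>M H \<rightarrow>\<^sub>M S"
  proof -
    let ?N = "P \<Otimes>\<^sub>M H \<Otimes>\<^sub>M T \<Otimes>\<^sub>M H"
    have r: "fst \<in> ?N \<rightarrow>\<^sub>M (\<Pi>\<^sub>M j\<in>J. euclid {..<d j})"
      unfolding P_def by (rule measurable_fst)
    have h': "(\<lambda>z. snd (snd (snd z))) \<in> ?N \<rightarrow>\<^sub>M euclid {..<d (Suc i)}"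
      unfolding H_def by measurable
    have a: "(\<lambda>z. merge (hat_ix d i) (tilde_ix d i) (fst (snd z), fst (snd (snd z)))) \<in> ?N \<rightarrow>\<^sub>M euclid {..<d i}"
      by measurable
    have "(\<lambda>z. (fst z)(Suc i := snd (snd (snd z)))) \<in> ?N \<rightarrow>\<^sub>M (\<Pi>\<^sub>M j\<in>insert (Suc i) J. euclid {..<d j})"
      by (rule upd_meas[OF _ r h']) simp
    from upd_meas[OF _ this a] have "(\<lambda>z. (fst z)(Suc i := snd (snd (snd z)),
        i := merge (hat_ix d i) (tilde_ix d i) (fst (snd z), fst (snd (snd z))))) \<in> ?N \<rightarrow>\<^sub>M S"
      unfolding S_def J(4) by simp
    then show ?thesis
      by (simp add: build_def split_beta')
  qed
  have sets_S: "sets (target_measure L d \<pi>) = sets S"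
    by (simp add: target_measure_def S_def)
  have target_meas: "target_density L \<pi> \<in> borel_measurable S"
    unfolding target_density_def[abs_def] S_def
    by (intro borel_measurable_prod \<pi>_comp) auto
  have target_build: "ennreal (target_density L \<pi> (build r h t h')) =
      ennreal (\<rho> r) * ennreal (f h t * \<pi> (Suc i) h')"
    if r: "r \<in> space P" and "h \<in> space H" "t \<in> space T" "h' \<in> space H" for r h t h'
  proof -
    have "0 \<le> \<rho> r"
      unfolding \<rho>_def using r by (intro prod_nonneg ballI \<pi>_nonneg) (auto simp: J_def P_def space_PiM)
    moreover have "(\<Prod>j\<in>J. \<pi> j (build r h t h' j)) = \<rho> r"
      unfolding \<rho>_def build_def by (intro prod.cong) (auto simp: J_def)
    then have "target_density L \<pi> (build r h t h') = \<rho> r * (f h t * \<pi> (Suc i) h')"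
      unfolding target_density_def J(4) using J(1-3)
      by (simp add: build_def f_def mult_ac)
    ultimately show ?thesis
      by (simp add: ennreal_mult')
  qed
  \<comment> \<open>Split off the levels \<open>i\<close> and \<open>i + 1\<close>, then split level \<open>i\<close> into its two parts.\<close>
  have disintegrate: "(\<integral>\<^sup>+x. F x \<partial>target_measure L d \<pi>) =
      (\<integral>\<^sup>+r. \<integral>\<^sup>+h'. \<integral>\<^sup>+h. \<integral>\<^sup>+t. ennreal (f h t * \<pi> (Suc i) h') * F (build r h t h') \<partial>T \<partial>H \<partial>H \<partial>R)"
    if F[measurable]: "F \<in> borel_measurable S" for F
  proof -
    let ?I = "\<lambda>r. \<integral>\<^sup>+h'. \<integral>\<^sup>+h. \<integral>\<^sup>+t. ennreal (f h t * \<pi> (Suc i) h') * F (build r h t h') \<partial>T \<partial>H \<partial>H"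
    let ?D = "\<lambda>x. ennreal (target_density L \<pi> x) * F x"
    have D[measurable]: "?D \<in> borel_measurable S"
      using target_meas by measurable
    have Fb[measurable (raw)]: "(\<lambda>z. F (build (a z) (b z) (c z) (e z))) \<in> borel_measurable N"
      if "a \<in> N \<rightarrow>\<^sub>M P" "b \<in> N \<rightarrow>\<^sub>M H" "c \<in> N \<rightarrow>\<^sub>M T" "e \<in> N \<rightarrow>\<^sub>M H" for a b c e and N :: "'x measure"
    proof -
      have "(\<lambda>z. (a z, b z, c z, e z)) \<in> N \<rightarrow>\<^sub>M P \<Otimes>\<^sub>M H \<Otimes>\<^sub>M T \<Otimes>\<^sub>M H"
        using that by measurable
      from measurable_compose[OF measurable_compose[OF this build_meas] F] show ?thesis by simp
    qed
    have fm[measurable (raw)]: "(\<lambda>z. f (b z) (c z)) \<in> borel_measurable N"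
      if "b \<in> N \<rightarrow>\<^sub>M H" "c \<in> N \<rightarrow>\<^sub>M T" for b c and N :: "'x measure"
      using measurable_compose[OF measurable_Pair[OF that] f_meas] by simp
    have "(\<integral>\<^sup>+x. F x \<partial>target_measure L d \<pi>) = (\<integral>\<^sup>+x. ?D x \<partial>S)"
      unfolding target_measure_def S_def[symmetric]
      using target_meas by (intro nn_integral_density F) measurable
    also have "\<dots> = (\<integral>\<^sup>+r. \<integral>\<^sup>+h'. \<integral>\<^sup>+a. ?D (r(Suc i := h', i := a)) \<partial>euclid {..<d i} \<partial>H \<partial>P)"
      using st.product_nn_integral_insert2[OF J(1-3) D[unfolded S_def J(4)]]
      unfolding S_def J(4) H_def P_def .
    also have "\<dots> = (\<integral>\<^sup>+r. \<integral>\<^sup>+h'. \<integral>\<^sup>+h. \<integral>\<^sup>+t. ?D (build r h t h') \<partial>T \<partial>H \<partial>H \<partial>P)"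
    proof (intro nn_integral_cong)
      fix r h' assume r: "r \<in> space P" and h': "h' \<in> space H"
      have "r(Suc i := h') \<in> space (\<Pi>\<^sub>M j\<in>insert (Suc i) J. euclid {..<d j})"
        using r h' by (auto simp: P_def H_def space_PiM PiE_iff extensional_def)
      then have "(\<lambda>a. r(Suc i := h', i := a)) \<in> euclid {..<d i} \<rightarrow>\<^sub>M S"
        unfolding S_def J(4) by (rule measurable_component_update[OF _ J(2)])
      from measurable_compose[OF this D]
      show "(\<integral>\<^sup>+a. ?D (r(Suc i := h', i := a)) \<partial>euclid {..<d i}) = (\<integral>\<^sup>+h. \<integral>\<^sup>+t. ?D (build r h t h') \<partial>T \<partial>H)"
        unfolding build_def T_def H_def Ui(1)
        by (intro lb.product_nn_integral_fold) (use Ui(2) in auto)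
    qed
    also have "\<dots> = (\<integral>\<^sup>+r. ennreal (\<rho> r) * ?I r \<partial>P)"
    proof (rule nn_integral_cong)
      fix r assume r[measurable]: "r \<in> space P"
      have "(\<integral>\<^sup>+h'. \<integral>\<^sup>+h. \<integral>\<^sup>+t. ?D (build r h t h') \<partial>T \<partial>H \<partial>H) = (\<integral>\<^sup>+h'. \<integral>\<^sup>+h. \<integral>\<^sup>+t.
          ennreal (\<rho> r) * (ennreal (f h t * \<pi> (Suc i) h') * F (build r h t h')) \<partial>T \<partial>H \<partial>H)"
        by (intro nn_integral_cong) (simp add: target_build r mult.assoc)
      also have "\<dots> = (\<integral>\<^sup>+h'. \<integral>\<^sup>+h. ennreal (\<rho> r) *
          (\<integral>\<^sup>+t. ennreal (f h t * \<pi> (Suc i) h') * F (build r h t h') \<partial>T) \<partial>H \<partial>H)"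
        by (intro nn_integral_cong nn_integral_cmult) measurable
      also have "\<dots> = (\<integral>\<^sup>+h'. ennreal (\<rho> r) *
          (\<integral>\<^sup>+h. \<integral>\<^sup>+t. ennreal (f h t * \<pi> (Suc i) h') * F (build r h t h') \<partial>T \<partial>H) \<partial>H)"
        by (intro nn_integral_cong nn_integral_cmult) measurable
      also have "\<dots> = ennreal (\<rho> r) * ?I r"
        by (intro nn_integral_cmult) measurable
      finally show "(\<integral>\<^sup>+h'. \<integral>\<^sup>+h. \<integral>\<^sup>+t. ?D (build r h t h') \<partial>T \<partial>H \<partial>H) = ennreal (\<rho> r) * ?I r" .
    qed
    also have "\<dots> = (\<integral>\<^sup>+r. ?I r \<partial>R)"
      unfolding R_def by (rule nn_integral_density[symmetric]) measurable
    finally show ?thesis .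
  qed
  interpret K: try_swap H T f "p i" "\<pi> (Suc i)" M S R "target_measure L d \<pi>"
    "\<lambda>x. restrict (x i) (hat_ix d i)" "\<lambda>x. restrict (x i) (tilde_ix d i)" "\<lambda>x. x (Suc i)"
    "swap_move d i" build
  proof
    show "case_prod f \<in> borel_measurable (H \<Otimes>\<^sub>M T)" "\<pi> (Suc i) \<in> borel_measurable H"
      by measurable
    show "case_prod (p i) \<in> borel_measurable (H \<Otimes>\<^sub>M T)"
      using q by (simp add: cond_prob_density_def)
    show "0 \<le> f h t" if "h \<in> space H" "t \<in> space T" for h t
      unfolding f_def using \<open>i < L\<close> by (intro \<pi>_nonneg merge_space that) simp
    show "0 \<le> p i h t" if "h \<in> space H" "t \<in> space T" for h t
      using q that by (auto simp: cond_prob_density_def prob_density_def)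
    show "0 \<le> \<pi> (Suc i) h" if "h \<in> space H" for h
      using that \<open>i < L\<close> unfolding H_def by (intro \<pi>_nonneg) auto
    show "(\<integral>\<^sup>+t. ennreal (p i h t) \<partial>T) = 1" if "h \<in> space H" for h
      using q that by (auto simp: cond_prob_density_def prob_density_def)
    show "0 < M"
      using \<open>M \<ge> 1\<close> by simp
    have xi: "(\<lambda>x. x i) \<in> S \<rightarrow>\<^sub>M euclid {..<d i}"
      unfolding S_def using \<open>i < L\<close> by (intro measurable_component_singleton) simp
    show hat: "(\<lambda>x. restrict (x i) (hat_ix d i)) \<in> S \<rightarrow>\<^sub>M H"
      using measurable_compose[OF xi[unfolded Ui(1)] measurable_restrict_subset[of "hat_ix d i"]]
      unfolding H_def by simp
    show "(\<lambda>x. restrict (x i) (tilde_ix d i)) \<in> S \<rightarrow>\<^sub>M T"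
      using measurable_compose[OF xi[unfolded Ui(1)] measurable_restrict_subset[of "tilde_ix d i"]]
      unfolding T_def by simp
    show nxt: "(\<lambda>x. x (Suc i)) \<in> S \<rightarrow>\<^sub>M H"
      unfolding S_def H_def using \<open>i < L\<close> by (intro measurable_component_singleton) simp
    show "case_prod (swap_move d i) \<in> S \<Otimes>\<^sub>M T \<rightarrow>\<^sub>M S"
    proof -
      have h'[measurable]: "(\<lambda>z. restrict (fst z i) (hat_ix d i)) \<in> S \<Otimes>\<^sub>M T \<rightarrow>\<^sub>M euclid {..<d (Suc i)}"
        using measurable_compose[OF measurable_fst hat] unfolding H_def .
      have mi[measurable]: "(\<lambda>z. merge (hat_ix d i) (tilde_ix d i) (fst z (Suc i), snd z)) \<in> S \<Otimes>\<^sub>M T \<rightarrow>\<^sub>M euclid {..<d i}"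
        using measurable_compose[OF measurable_Pair[OF measurable_compose[OF measurable_fst nxt] measurable_snd] merge_meas] .
      have fst_S: "fst \<in> S \<Otimes>\<^sub>M T \<rightarrow>\<^sub>M state_space L d"
        unfolding S_def by measurable
      have "(\<lambda>z. (fst z)(i := merge (hat_ix d i) (tilde_ix d i) (fst z (Suc i), snd z)))
          \<in> S \<Otimes>\<^sub>M T \<rightarrow>\<^sub>M state_space L d"
        by (rule upd_meas[OF _ fst_S mi]) (use \<open>i < L\<close> in \<open>simp add: insert_absorb\<close>)
      from upd_meas[OF _ this h'] have "(\<lambda>z. (fst z)(i := merge (hat_ix d i) (tilde_ix d i) (fst z (Suc i), snd z),
          Suc i := restrict (fst z i) (hat_ix d i))) \<in> S \<Otimes>\<^sub>M T \<rightarrow>\<^sub>M state_space L d"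
        using \<open>i < L\<close> by (simp add: insert_absorb)
      then show ?thesis
        by (simp add: swap_move_def[abs_def] split_beta' S_def)
    qed
    show "(\<lambda>(h, t, h'). build r h t h') \<in> H \<Otimes>\<^sub>M T \<Otimes>\<^sub>M H \<rightarrow>\<^sub>M S" if "r \<in> space R" for r
    proof -
      have "r \<in> space P" using that by (simp add: R_def)
      from measurable_Pair2[OF build_meas this] show ?thesis by simp
    qed
    show "restrict (build r h t h' i) (hat_ix d i) = h" if "h \<in> space H" for r h t h'
      using that Ui(2) by (simp add: build_def H_def space_PiM PiE_iff extensional_restrict)
    show "restrict (build r h t h' i) (tilde_ix d i) = t" if "t \<in> space T" for r h t h'
      using that Ui(2) by (simp add: build_def T_def space_PiM PiE_iff extensional_restrict)
    show "build r h t h' (Suc i) = h'" for r h t h'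
      by (simp add: build_def)
    show "swap_move d i (build r h t h') s = build r h' s h" if "h \<in> space H" for r h t h' s
      using that Ui(2)
      by (simp add: swap_move_def build_def H_def space_PiM PiE_iff extensional_restrict fun_upd_twist)
    show "sets (target_measure L d \<pi>) = sets S"
      by (rule sets_S)
    show "(\<integral>\<^sup>+x. F x \<partial>target_measure L d \<pi>) =
      (\<integral>\<^sup>+r. \<integral>\<^sup>+h'. \<integral>\<^sup>+h. \<integral>\<^sup>+t. ennreal (f h t * \<pi> (Suc i) h') * F (build r h t h') \<partial>T \<partial>H \<partial>H \<partial>R)"
      if "F \<in> borel_measurable S" for F
      by (rule disintegrate[OF that])
  qed
  have w: "K.w = weight d \<pi> p i"
    by (simp add: fun_eq_iff K.w_def weight_def f_def)
  have W: "K.W = total_weight d \<pi> p M i"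
    by (simp add: fun_eq_iff K.W_def total_weight_def w)
  have ok: "K.ok = ratios_defined d \<pi> p M i"
    by (simp add: fun_eq_iff K.ok_def ratios_defined_def W)
  have acc: "K.acc = accept_prob d \<pi> p M i"
    by (simp add: fun_eq_iff K.acc_def accept_prob_def W)
  have "K.kernel = swap_kernel L d \<pi> p M i"
    by (rule ext) (simp only: K.kernel_def K.step_def K.proposal_def swap_kernel_def Let_def w W ok acc
        T_def[symmetric] S_def[symmetric])
  with K.detailed_balance_kernel show ?thesis
    by simp
qed

end
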